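(* Let $p>3$ be a prime. Then $$\left(\frac{-1}p\right)\sum_{k=0}^{p-1}\frac{\binom{2k}k^2}{16^k}H_k\equiv-4q_p(2)+2p\,q_p(2)^2\pmod{p^2},$$ $$\left(\frac p3\right)\sum_{k=0}^{p-1}\frac{\binom{2k}k\binom{3k}k}{27^k}H_k\equiv-3q_p(3)+\frac32p\,q_p(3)^2\pmod{p^2},$$ $$\left(\frac{-2}p\right)\sum_{k=0}^{p-1}\frac{\binom{4k}{2k}\binom{2k}k}{64^k}H_k\equiv-6q_p(2)+3p\,q_p(2)^2\pmod{p^2},$$ and $$\left(\frac{-1}p\right)\sum_{k=0}^{p-1}\frac{\binom{6k}{3k}\binom{3k}k}{432^k}H_k\equiv-3q_p(3)-4q_p(2)+p\left(\frac32q_p(3)^2+2q_p(2)^2\right)\pmod{p^2}.$$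
   Context: For $n\in\mathbb N=\{0,1,2,\ldots\}$, $H_n=\sum_{0<k\le n}\frac1k$ is the harmonic number. $\left(\frac{\cdot}{p}\right)$ and $\left(\frac{\cdot}{3}\right)$ denote Legendre symbols. For a prime $p$ and an integer $a\not\equiv0\pmod p$, $q_p(a)=(a^{p-1}-1)/p$ is the Fermat quotient. Congruences modulo $p^2$ are in the ring $\mathbb Z_p$ of $p$-adic integers (equivalently, among rationals with denominator prime to $p$). *)

theory Defs
  imports "HOL-Number_Theory.Number_Theory"
begin

(* Rational-valued: the library's harm is restricted to real_normed_field,
   of which rat is not an instance. *)
definition harmonic :: "nat \<Rightarrow> rat" where
  "harmonic n = (\<Sum>k\<in>{0<..n}. 1 / of_nat k)"

definition fermat_quotient :: "nat \<Rightarrow> int \<Rightarrow> rat" where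
  "fermat_quotient p a = (of_int a ^ (p - 1) - 1) / of_nat p"

(* The rationals that are p-adic integers. *)
definition p_integers :: "nat \<Rightarrow> rat set" where
  "p_integers p = {of_int a / of_int b | a b. b \<noteq> 0 \<and> coprime b (int p)}"

(* The congruence x = y modulo p^n in the ring p_integers p: both sides must lie
   in that ring and their difference in its ideal generated by p^n. *)
definition pcong :: "nat \<Rightarrow> nat \<Rightarrow> rat \<Rightarrow> rat \<Rightarrow> bool" where
  "pcong p n x y \<longleftrightarrow> x \<in> p_integers p \<and> y \<in> p_integers p \<and>
     (\<exists>z\<in>p_integers p. x - y = of_nat (p ^ n) * z)"

end

(*
  Write u_k(a) = C(a,k) C(-1-a,k), P_k(a) = (1 - a^2/1^2)...(1 - a^2/k^2), and let
  A(a), T(a) be the sums over k < p of u_k(a) and of u_k(a) H_k.  The four summands are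
  u_k(-1/n) for n = 2, 3, 4, 6.  Since u_k(a) and u_k(a-1) are -a(a+k)/k^2 and
  -a(a-k)/k^2 times P_{k-1}(a), telescoping gives
    A(a) + A(a-1) = 2 P_{p-1}(a),
    a (T(a) + T(a-1)) = 2 a P_{p-1}(a) H_{p-1} + A(a) - A(a-1).
  If a = m + p t with 0 < m < p, then p^2 divides P_{p-1}(a), so that A(a) = (-1)^m and
  T(a) + T(a-1) = 2 (-1)^m / a modulo p^2; as T(p t) = 0, induction on m evaluates T(a).
  For t = -1/n and m = p div n, where a is -1/n or -1 + 1/n, the result is -2n (-1)^m times
  the sum of 1/r over 0 < r < p with r = p (mod n).

  These sums over residue classes follow from n^(p-1) = prod_{0<k<p} (1 + p f_k / r_k), where
  n k = r_k + p f_k with 0 < r_k < p, upon taking logarithms modulo p^3, together with the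
  reflection r -> p - r and the splitting of classes modulo 2 and 3 into classes modulo 4 and 6.
*)

theory Submission
  imports Defs
begin

section \<open>The ring of p-integral rationals and its ideals\<close>

lemma of_int_in_p_integers [simp]: "of_int a \<in> p_integers p"
  unfolding p_integers_def by (rule CollectI, rule exI[of _ a], rule exI[of _ 1]) simp

lemma of_nat_in_p_integers [simp]: "of_nat a \<in> p_integers p"
  using of_int_in_p_integers[of "int a" p] by simp

lemma numeral_in_p_integers [simp]: "numeral a \<in> p_integers p"
  using of_int_in_p_integers[of "numeral a" p] by simp

lemma zero_one_in_p_integers [simp]: "0 \<in> p_integers p" "1 \<in> p_integers p"
  using of_int_in_p_integers[of 0 p] of_int_in_p_integers[of 1 p] by simp_all

lemma p_integers_add:
  assumes "x \<in> p_integers p" "y \<in> p_integers p"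
  shows "x + y \<in> p_integers p"
proof -
  obtain a b c d where x: "x = of_int a / of_int b" and b: "b \<noteq> 0" "coprime b (int p)"
    and y: "y = of_int c / of_int d" and d: "d \<noteq> 0" "coprime d (int p)"
    using assms unfolding p_integers_def by blast
  have "x + y = of_int (a * d + c * b) / of_int (b * d)"
    using b d by (simp add: x y field_simps)
  moreover have "b * d \<noteq> 0" "coprime (b * d) (int p)" using b d by auto
  ultimately show ?thesis unfolding p_integers_def by blast
qed

lemma p_integers_mult:
  assumes "x \<in> p_integers p" "y \<in> p_integers p"
  shows "x * y \<in> p_integers p"
proof -
  obtain a b c d where x: "x = of_int a / of_int b" and b: "b \<noteq> 0" "coprime b (int p)"
    and y: "y = of_int c / of_int d" and d: "d \<noteq> 0" "coprime d (int p)"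
    using assms unfolding p_integers_def by blast
  have "x * y = of_int (a * c) / of_int (b * d)"
    by (simp add: x y)
  moreover have "b * d \<noteq> 0" "coprime (b * d) (int p)" using b d by auto
  ultimately show ?thesis unfolding p_integers_def by blast
qed

lemma p_integers_minus: "x \<in> p_integers p \<Longrightarrow> - x \<in> p_integers p"
  using p_integers_mult[of "of_int (-1)" p x] of_int_in_p_integers[of "-1" p] by simp

lemma p_integers_diff: "x \<in> p_integers p \<Longrightarrow> y \<in> p_integers p \<Longrightarrow> x - y \<in> p_integers p"
  using p_integers_add[of x p "- y"] p_integers_minus[of y p] by simp

lemma p_integers_power: "x \<in> p_integers p \<Longrightarrow> x ^ k \<in> p_integers p"
  by (induction k) (auto intro: p_integers_mult)

lemma p_integers_sum: "(\<And>i. i \<in> A \<Longrightarrow> f i \<in> p_integers p) \<Longrightarrow> sum f A \<in> p_integers p"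
  by (induction A rule: infinite_finite_induct) (auto intro: p_integers_add)

lemmas p_integers_intros =
  p_integers_add p_integers_mult p_integers_minus p_integers_diff p_integers_power p_integers_sum

lemma p_integers_divide_nat:
  assumes "x \<in> p_integers p" "coprime k p" "k > 0"
  shows "x / of_nat k \<in> p_integers p"
proof -
  have "coprime (int k) (int p)" using assms(2) by simp
  then have "1 / of_nat k \<in> p_integers p"
    using assms(3) unfolding p_integers_def
    by (intro CollectI exI[of _ 1] exI[of _ "int k"]) auto
  from p_integers_mult[OF assms(1) this] show ?thesis by simp
qed

text \<open>Congruences are handled as membership of the difference in the ideal generated by
  \<open>p ^ n\<close>, so that error terms can be added, scaled and multiplied;
  \<open>pcong\<close> returns only at the very end.\<close>

definition p_ideal :: "nat \<Rightarrow> nat \<Rightarrow> rat set" where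
  "p_ideal p n = {of_nat p ^ n * z | z. z \<in> p_integers p}"

lemma p_idealI: "z \<in> p_integers p \<Longrightarrow> x = of_nat p ^ n * z \<Longrightarrow> x \<in> p_ideal p n"
  unfolding p_ideal_def by blast

lemma p_idealE:
  assumes "x \<in> p_ideal p n"
  obtains z where "z \<in> p_integers p" "x = of_nat p ^ n * z"
  using assms unfolding p_ideal_def by blast

lemma p_ideal_zero [simp]: "0 \<in> p_ideal p n"
  by (rule p_idealI[of 0]) auto

lemma p_ideal_0_eq: "p_ideal p 0 = p_integers p"
  unfolding p_ideal_def by simp

lemma p_ideal_add: "x \<in> p_ideal p n \<Longrightarrow> y \<in> p_ideal p n \<Longrightarrow> x + y \<in> p_ideal p n"
  by (elim p_idealE, rule p_idealI, rule p_integers_add, assumption, assumption)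
     (simp add: algebra_simps)

lemma p_ideal_mult: "x \<in> p_ideal p m \<Longrightarrow> y \<in> p_ideal p n \<Longrightarrow> x * y \<in> p_ideal p (m + n)"
  by (elim p_idealE, rule p_idealI, rule p_integers_mult, assumption, assumption)
     (simp add: power_add)

lemma p_ideal_lmult: "x \<in> p_integers p \<Longrightarrow> y \<in> p_ideal p n \<Longrightarrow> x * y \<in> p_ideal p n"
  using p_ideal_mult[of x p 0 y n] by (simp add: p_ideal_0_eq)

lemma p_ideal_rmult: "x \<in> p_ideal p n \<Longrightarrow> y \<in> p_integers p \<Longrightarrow> x * y \<in> p_ideal p n"
  using p_ideal_lmult[of y p x n] by (simp add: mult.commute)

lemma p_ideal_minus: "x \<in> p_ideal p n \<Longrightarrow> - x \<in> p_ideal p n"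
  using p_ideal_lmult[of "-1" p x n] p_integers_minus[of 1 p] by simp

lemma p_ideal_diff: "x \<in> p_ideal p n \<Longrightarrow> y \<in> p_ideal p n \<Longrightarrow> x - y \<in> p_ideal p n"
  using p_ideal_add[of x p n "- y"] p_ideal_minus[of y p n] by simp

lemma p_ideal_sum: "(\<And>i. i \<in> A \<Longrightarrow> f i \<in> p_ideal p n) \<Longrightarrow> sum f A \<in> p_ideal p n"
  by (induction A rule: infinite_finite_induct) (auto intro: p_ideal_add)

lemma p_ideal_power: "z \<in> p_integers p \<Longrightarrow> of_nat p ^ n * z \<in> p_ideal p n"
  by (rule p_idealI) auto

lemma p_ideal_p: "z \<in> p_integers p \<Longrightarrow> of_nat p * z \<in> p_ideal p 1"
  by (rule p_idealI) auto

lemma p_ideal_mult_p: "x \<in> p_ideal p n \<Longrightarrow> of_nat p * x \<in> p_ideal p (Suc n)"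
  using p_ideal_mult[OF p_ideal_p[of 1 p], of x n] by simp

lemma p_ideal_integer: "x \<in> p_ideal p n \<Longrightarrow> x \<in> p_integers p"
  unfolding p_ideal_def by (auto intro!: p_integers_mult p_integers_power)

lemma p_ideal_divide_nat:
  "x \<in> p_ideal p n \<Longrightarrow> coprime k p \<Longrightarrow> k > 0 \<Longrightarrow> x / of_nat k \<in> p_ideal p n"
  using p_ideal_rmult[of x p n "1 / of_nat k"] p_integers_divide_nat[of 1 p k] by simp

text \<open>The ideal lies inside the ring, so integrality of \<open>x\<close> follows from that of
  \<open>y\<close> and of the difference.\<close>

lemma pcongI:
  assumes "y \<in> p_integers p" "x - y \<in> p_ideal p n"
  shows "pcong p n x y"
proof -
  have "x = y + (x - y)" by simp
  also have "\<dots> \<in> p_integers p"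
    using assms by (intro p_integers_add p_ideal_integer[OF assms(2)])
  finally show ?thesis
    using assms unfolding pcong_def p_ideal_def by auto
qed

section \<open>Telescoping identities\<close>

definition gbinomial_pair :: "rat \<Rightarrow> nat \<Rightarrow> rat" where
  "gbinomial_pair a k = (a gchoose k) * ((-1 - a) gchoose k)"

text \<open>A partial product of Euler's product for sin(pi a) / (pi a).\<close>

definition quad_prod :: "rat \<Rightarrow> nat \<Rightarrow> rat" where
  "quad_prod a k = (\<Prod>j=1..k. 1 - a\<^sup>2 / of_nat j ^ 2)"

lemma quad_prod_0 [simp]: "quad_prod a 0 = 1"
  by (simp add: quad_prod_def)

lemma quad_prod_Suc: "quad_prod a (Suc k) = quad_prod a k * (1 - a\<^sup>2 / of_nat (Suc k) ^ 2)"
  by (simp add: quad_prod_def)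

lemma quad_prod_minus [simp]: "quad_prod (- a) k = quad_prod a k"
  by (simp add: quad_prod_def)

lemma gbinomial_pair_0 [simp]: "gbinomial_pair a 0 = 1"
  by (simp add: gbinomial_pair_def)

text \<open>Only a (a + 1) occurs in the ratio, which displays the symmetry under a -> -1 -
  a.\<close>

lemma gbinomial_pair_Suc:
  "gbinomial_pair a (Suc k) =
     gbinomial_pair a k * (of_nat k * of_nat (Suc k) - a * (a + 1)) / of_nat (Suc k) ^ 2"
proof -
  have *: "(b gchoose Suc k) = (b gchoose k) * (b - of_nat k) / of_nat (Suc k)" for b :: rat
    using gbinomial_mult_1[of b k] by (simp add: field_simps)
  have "gbinomial_pair a (Suc k) =
      gbinomial_pair a k * ((a - of_nat k) * (- 1 - a - of_nat k)) / of_nat (Suc k) ^ 2"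
    unfolding gbinomial_pair_def * by (simp add: power2_eq_square)
  also have "(a - of_nat k) * (- 1 - a - of_nat k) = of_nat k * of_nat (Suc k) - a * (a + 1)"
    by (simp add: algebra_simps)
  finally show ?thesis .
qed

lemma gbinomial_pair_reflect: "gbinomial_pair (- a) k = gbinomial_pair (a - 1) k"
  by (simp add: gbinomial_pair_def mult.commute)

text \<open>With x = k + 1, the ratio of consecutive terms contains (x - a) (x + 1 + a). The factor
  x - a joins the old end factor a + x to give the new factor 1 - a^2/x^2 of the product, and x + 1
  + a is the new end factor.\<close>

lemma gbinomial_pair_Suc_eq_quad_prod:
  "gbinomial_pair a (Suc k) = - a * (a + of_nat (Suc k)) / of_nat (Suc k) ^ 2 * quad_prod a k"
proof (induction k)
  case 0
  then show ?case by (simp add: gbinomial_pair_Suc)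
next
  case (Suc k)
  define x :: rat where "x = of_nat (Suc k)"
  have x: "x \<noteq> 0" "x + 1 \<noteq> 0" "of_nat (Suc (Suc k)) = x + 1"
    by (auto simp: x_def simp flip: of_nat_Suc)
  have "gbinomial_pair a (Suc (Suc k)) =
      (- a * (a + x) / x\<^sup>2 * quad_prod a k) * (x * (x + 1) - a * (a + 1)) / (x + 1)\<^sup>2"
    by (simp only: gbinomial_pair_Suc[of a "Suc k"] Suc.IH x(3) flip: x_def)
  also have "(x * (x + 1) - a * (a + 1)) = (x - a) * (x + 1 + a)" by (simp add: algebra_simps)
  also have "(- a * (a + x) / x\<^sup>2 * quad_prod a k) * \<dots> / (x + 1)\<^sup>2
      = - a * (a + (x + 1)) / (x + 1)\<^sup>2 * (quad_prod a k * ((x\<^sup>2 - a\<^sup>2) / x\<^sup>2))"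
    by (simp add: power2_eq_square algebra_simps)
  also have "(x\<^sup>2 - a\<^sup>2) / x\<^sup>2 = 1 - a\<^sup>2 / x\<^sup>2" using x by (simp add: field_simps)
  finally show ?case by (simp only: x(3) quad_prod_Suc flip: x_def)
qed

text \<open>The preceding formula at -a: the product is even in a, and the pair at -a is the pair at
  a - 1.\<close>

lemma gbinomial_pair_Suc_shift_eq_quad_prod:
  "gbinomial_pair (a - 1) (Suc k) = - a * (a - of_nat (Suc k)) / of_nat (Suc k) ^ 2 * quad_prod a k"
  using gbinomial_pair_Suc_eq_quad_prod[of "- a" k]
  by (simp add: gbinomial_pair_reflect algebra_simps)

definition pair_sum :: "rat \<Rightarrow> nat \<Rightarrow> rat" where
  "pair_sum a N = (\<Sum>k\<le>N. gbinomial_pair a k)"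

definition pair_harmonic_sum :: "rat \<Rightarrow> nat \<Rightarrow> rat" where
  "pair_harmonic_sum a N = (\<Sum>k\<le>N. gbinomial_pair a k * harmonic k)"

lemma harmonic_0 [simp]: "harmonic 0 = 0"
  by (simp add: harmonic_def)

lemma harmonic_Suc: "harmonic (Suc n) = harmonic n + 1 / of_nat (Suc n)"
proof -
  have "{0<..Suc n} = insert (Suc n) {0<..n}" by auto
  then show ?thesis by (simp add: harmonic_def)
qed

text \<open>The linear parts cancel: a (a + k) + a (a - k) = 2 a^2, and -a^2/k^2 times the product
  up to k - 1 is exactly the increment of the product.\<close>

lemma gbinomial_pair_add_shift:
  "gbinomial_pair a (Suc k) + gbinomial_pair (a - 1) (Suc k)
     = 2 * (quad_prod a (Suc k) - quad_prod a k)"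
  unfolding gbinomial_pair_Suc_eq_quad_prod[of a] gbinomial_pair_Suc_shift_eq_quad_prod quad_prod_Suc
  by (simp add: power2_eq_square divide_simps del: of_nat_Suc) (simp add: algebra_simps)

lemma gbinomial_pair_diff_shift:
  "gbinomial_pair a (Suc k) - gbinomial_pair (a - 1) (Suc k)
     = - 2 * a * (quad_prod a k / of_nat (Suc k))"
  unfolding gbinomial_pair_Suc_eq_quad_prod[of a] gbinomial_pair_Suc_shift_eq_quad_prod
  by (simp add: power2_eq_square divide_simps del: of_nat_Suc) (simp add: algebra_simps)

lemma pair_sum_add_shift: "pair_sum a N + pair_sum (a - 1) N = 2 * quad_prod a N"
proof (induction N)
  case (Suc N)
  have "pair_sum a (Suc N) + pair_sum (a - 1) (Suc N) = (pair_sum a N + pair_sum (a - 1) N)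
      + (gbinomial_pair a (Suc N) + gbinomial_pair (a - 1) (Suc N))"
    by (simp add: pair_sum_def)
  then show ?case by (simp only: Suc.IH gbinomial_pair_add_shift) simp
qed (simp add: pair_sum_def)

text \<open>Summation by parts: the increments of \<open>quad_prod\<close> are weighted with
  \<open>harmonic\<close>, and the remaining terms \<open>quad_prod a k / of_nat (Suc k)\<close> are
  absorbed by the differences of the two pairs.\<close>

lemma pair_harmonic_sum_add_shift:
  "a * (pair_harmonic_sum a N + pair_harmonic_sum (a - 1) N)
     = 2 * a * quad_prod a N * harmonic N + (pair_sum a N - pair_sum (a - 1) N)"
proof (induction N)
  case (Suc N)
  have "a * (pair_harmonic_sum a (Suc N) + pair_harmonic_sum (a - 1) (Suc N))
      = a * (pair_harmonic_sum a N + pair_harmonic_sum (a - 1) N)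
      + a * (gbinomial_pair a (Suc N) + gbinomial_pair (a - 1) (Suc N)) * harmonic (Suc N)"
    by (simp add: pair_harmonic_sum_def algebra_simps)
  moreover have "pair_sum a (Suc N) - pair_sum (a - 1) (Suc N)
      = pair_sum a N - pair_sum (a - 1) N + (gbinomial_pair a (Suc N) - gbinomial_pair (a - 1) (Suc N))"
    by (simp add: pair_sum_def)
  ultimately show ?case
    unfolding Suc.IH gbinomial_pair_add_shift gbinomial_pair_diff_shift harmonic_Suc
    by (simp add: algebra_simps)
qed (simp add: pair_sum_def pair_harmonic_sum_def)

section \<open>Reciprocal sums over residue classes\<close>

locale prime_gt_3 =
  fixes p :: nat
  assumes prime_p: "prime p" and p_gt_3: "p > 3"
begin

abbreviation "Zp \<equiv> p_integers p"
abbreviation "Ip \<equiv> p_ideal p"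

lemma coprime_less: "0 < k \<Longrightarrow> k < p \<Longrightarrow> coprime k p"
  using prime_p by (metis coprime_commute nat_dvd_not_less prime_imp_coprime_nat)

lemma divide_less_in_Zp: "x \<in> Zp \<Longrightarrow> 0 < k \<Longrightarrow> k < p \<Longrightarrow> x / of_nat k \<in> Zp"
  by (intro p_integers_divide_nat coprime_less)

lemma coprime_6: "coprime 2 p" "coprime 3 p" "coprime 4 p" "coprime 6 p" "coprime 12 p"
proof -
  show *: "coprime 2 p" "coprime 3 p" using p_gt_3 by (intro coprime_less; simp)+
  have "coprime (2 * 2) p" "coprime (2 * 3) p" "coprime (2 * (2 * 3)) p"
    using * unfolding coprime_mult_left_iff by blast+
  then show "coprime 4 p" "coprime 6 p" "coprime 12 p" by simp_all
qed

lemma odd_p: "odd p"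
  using coprime_6(1) by simp

lemma half_in_ideal: "x \<in> Ip n \<Longrightarrow> x / 2 \<in> Ip n"
  using p_ideal_divide_nat[of x p n 2] coprime_6 by simp

lemma half_in_Zp: "x \<in> Zp \<Longrightarrow> x / 2 \<in> Zp"
  using p_integers_divide_nat[of x p 2] coprime_6 by simp

text \<open>Indexed so that the class of \<open>f\<close> contains the remainders \<open>n * k mod p\<close> with \<open>n * k div p = f\<close>.\<close>

definition residue_class :: "nat \<Rightarrow> nat \<Rightarrow> nat set" where
  "residue_class n f = {r \<in> {0<..<p}. n dvd r + p * f}"

definition class_sum :: "nat \<Rightarrow> nat \<Rightarrow> rat" where
  "class_sum n f = (\<Sum>r\<in>residue_class n f. 1 / of_nat r)"

definition class_sum2 :: "nat \<Rightarrow> nat \<Rightarrow> rat" where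
  "class_sum2 n f = (\<Sum>r\<in>residue_class n f. 1 / of_nat r ^ 2)"

lemma finite_residue_class [simp]: "finite (residue_class n f)"
  by (simp add: residue_class_def)

lemma mult_mod_p_in:
  assumes "coprime n p" "k \<in> {0<..<p}"
  shows "n * k mod p \<in> {0<..<p}"
proof -
  have "\<not> p dvd k" using assms(2) by (auto dest: dvd_imp_le)
  moreover have "\<not> p dvd n"
    using assms(1) prime_p by (metis coprime_common_divisor_nat dvd_refl not_prime_1)
  ultimately have "\<not> p dvd n * k" using prime_p by (simp add: prime_dvd_mult_iff)
  then show ?thesis using p_gt_3 by (simp add: dvd_eq_mod_eq_0)
qed

lemma bij_betw_mult_mod_p:
  assumes "coprime n p"
  shows "bij_betw (\<lambda>k. n * k mod p) {0<..<p} {0<..<p}"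
proof -
  have "inj_on (\<lambda>k. n * k mod p) {0<..<p}"
  proof (rule inj_onI)
    fix k l assume kl: "k \<in> {0<..<p}" "l \<in> {0<..<p}" "n * k mod p = n * l mod p"
    then have "[n * k = n * l] (mod p)" by (simp add: cong_def)
    then have "[k = l] (mod p)" using assms by (simp add: cong_mult_lcancel_nat)
    then show "k = l" using kl by (simp add: cong_def)
  qed
  moreover have "(\<lambda>k. n * k mod p) ` {0<..<p} \<subseteq> {0<..<p}"
    using mult_mod_p_in[OF assms] by blast
  ultimately show ?thesis
    by (metis bij_betw_imageI endo_inj_surj finite_greaterThanLessThan)
qed

text \<open>Division of n k by p is a bijection onto the pairs (f, r) with f < n and r in class f,
  because k is recovered as (r + p f) / n.\<close>

lemma sum_div_mod_eq_sum_residue_class: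
  assumes n: "n > 0" "coprime n p"
  shows "(\<Sum>k\<in>{0<..<p}. h (n * k div p) (n * k mod p)) = (\<Sum>f<n. \<Sum>r\<in>residue_class n f. h f r)"
proof -
  have "(\<Sum>f<n. \<Sum>r\<in>residue_class n f. h f r)
      = (\<Sum>(f, r)\<in>Sigma {..<n} (residue_class n). h f r)"
    by (rule sum.Sigma) auto
  also have "\<dots> = (\<Sum>k\<in>{0<..<p}. h (n * k div p) (n * k mod p))"
  proof (rule sum.reindex_bij_witness[where
        i = "\<lambda>k. (n * k div p, n * k mod p)" and j = "\<lambda>(f, r). (r + p * f) div n"])
    fix x assume "x \<in> Sigma {..<n} (residue_class n)"
    then obtain f r where x: "x = (f, r)" "f < n" "0 < r" "r < p" "n dvd r + p * f"
      by (auto simp: residue_class_def)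
    define k where "k = (r + p * f) div n"
    have k: "n * k = r + p * f" using x by (simp add: k_def)
    have f: "n * k div p = f" "n * k mod p = r" using x by (simp_all add: k)
    have "k > 0" using k x by (metis add_is_0 less_numeral_extra(3) mult_0_right neq0_conv)
    \<comment> \<open>From r < p it follows that r + p f < p (f + 1) \<le> p n, which forces k <
      p.\<close>
    moreover have "p * Suc f \<le> p * n" using x by (intro mult_le_mono2) auto
    then have "n * k < n * p" using k x by (simp add: mult.commute)
    then have "k < p" by simp
    ultimately show "(case x of (f, r) \<Rightarrow> (r + p * f) div n) \<in> {0<..<p}"
      using x by (simp add: k_def)
    show "(n * (case x of (f, r) \<Rightarrow> (r + p * f) div n) div p,
        n * (case x of (f, r) \<Rightarrow> (r + p * f) div n) mod p) = x"
      "h (n * (case x of (f, r) \<Rightarrow> (r + p * f) div n) div p)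
        (n * (case x of (f, r) \<Rightarrow> (r + p * f) div n) mod p) = (case x of (f, r) \<Rightarrow> h f r)"
      using f by (simp_all add: x(1) flip: k_def)
  next
    fix k assume k: "k \<in> {0<..<p}"
    have "n * k div p < n"
      using k n by (simp add: less_mult_imp_div_less)
    then show "(n * k div p, n * k mod p) \<in> Sigma {..<n} (residue_class n)"
      using mult_mod_p_in[OF n(2) k] by (simp add: residue_class_def)
    show "(case (n * k div p, n * k mod p) of (f, r) \<Rightarrow> (r + p * f) div n) = k"
      using n by simp
  qed
  finally show ?thesis ..
qed

lemma sum_residue_classes:
  assumes "n > 0" "coprime n p"
  shows "(\<Sum>f<n. \<Sum>r\<in>residue_class n f. h r) = (\<Sum>r\<in>{0<..<p}. h r)"
  using sum_div_mod_eq_sum_residue_class[OF assms, of "\<lambda>f. h"]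
    sum.reindex_bij_betw[OF bij_betw_mult_mod_p[OF assms(2)], of h] by simp

section \<open>Inverse squares modulo p, and the reflection r -> p - r\<close>

lemma residue_class_1 [simp]: "residue_class (Suc 0) 0 = {0<..<p}"
  by (auto simp: residue_class_def)

text \<open>Doubling permutes the nonzero residues, so the sum S of inverse squares satisfies S =
  S/4 modulo p; hence p divides 3 S, and 3 is invertible.\<close>

lemma class_sum2_1_in_ideal: "class_sum2 1 0 \<in> Ip 1"
proof -
  have *: "1 / of_nat (2 * k mod p) ^ 2 - 1 / of_nat (2 * k) ^ 2 \<in> Ip 1" if k: "k \<in> {0<..<p}" for k
  proof -
    define x where "x = 2 * k mod p"
    define f where "f = 2 * k div p"
    have x: "0 < x" "x < p" using mult_mod_p_in[OF coprime_6(1) k] by (auto simp: x_def)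
    have y: "2 * k = x + p * f" by (simp add: x_def f_def)
    have k2: "coprime (2 * k) p" "2 * k > 0" using coprime_6 coprime_less k by auto
    have "1 / of_nat x ^ 2 - 1 / of_nat (2 * k) ^ 2
        = (of_nat (2 * k) - of_nat x) * (of_nat (2 * k) + of_nat x)
          / of_nat x / of_nat x / of_nat (2 * k) / (of_nat (2 * k) :: rat)"
      using x k2 by (simp add: field_simps power2_eq_square del: of_nat_mult)
    also have "of_nat (2 * k) - of_nat x = (of_nat p * of_nat f :: rat)" by (simp add: y del: mult_2)
    also have "\<dots> * (of_nat (2 * k) + of_nat x) = of_nat p * (of_nat f * (of_nat (2 * k) + of_nat x))"
      by (simp add: algebra_simps)
    also have "\<dots> / of_nat x / of_nat x / of_nat (2 * k) / of_nat (2 * k) \<in> Ip 1"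
      using x k2
      by (intro p_ideal_divide_nat p_ideal_p p_integers_intros coprime_less[of x] of_nat_in_p_integers)
    finally show ?thesis
      unfolding x_def .
  qed
  have "class_sum2 1 0 = (\<Sum>k\<in>{0<..<p}. 1 / of_nat (2 * k mod p) ^ 2)"
    using sum.reindex_bij_betw[OF bij_betw_mult_mod_p[OF coprime_6(1)],
        of "\<lambda>r. 1 / of_nat r ^ 2 :: rat"]
    by (simp add: class_sum2_def)
  moreover have "class_sum2 1 0 = 4 * (\<Sum>k\<in>{0<..<p}. 1 / of_nat (2 * k) ^ 2)"
    by (simp add: class_sum2_def sum_distrib_left power_mult_distrib)
  moreover have "(\<Sum>k\<in>{0<..<p}. 1 / of_nat (2 * k mod p) ^ 2 - 1 / of_nat (2 * k) ^ 2) \<in> Ip 1"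
    using * by (rule p_ideal_sum)
  ultimately have "class_sum2 1 0 - class_sum2 1 0 / 4 \<in> Ip 1"
    by (simp add: sum_subtractf del: of_nat_mult)
  then have "4 * (class_sum2 1 0 - class_sum2 1 0 / 4) / of_nat 3 \<in> Ip 1"
    using coprime_6 by (intro p_ideal_divide_nat p_ideal_lmult) auto
  then show ?thesis by simp
qed

lemma sum_class_sum2_in_ideal:
  assumes "n > 0" "coprime n p"
  shows "(\<Sum>f<n. class_sum2 n f) \<in> Ip 1"
  using sum_residue_classes[OF assms, of "\<lambda>r. 1 / of_nat r ^ 2 :: rat"] class_sum2_1_in_ideal
  by (simp add: class_sum2_def)

text \<open>The numbers (p - r) + p (n - 1 - f) and r + p f add up to p n, so r -> p - r exchanges
  the classes f and n - 1 - f.\<close>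

lemma sum_residue_class_reflect:
  assumes "f < n"
  shows "(\<Sum>r\<in>residue_class n (n - 1 - f). h r) = (\<Sum>r\<in>residue_class n f. h (p - r))"
proof -
  have *: "n dvd (p - r) + p * (n - 1 - g)" if "n dvd r + p * g" "r < p" "g < n" for r g
  proof -
    define d where "d = n - 1 - g"
    have d: "n = Suc (d + g)" using that by (simp add: d_def)
    have "(p - r) + p * d + (r + p * g) = p * n"
      using that by (simp add: d algebra_simps)
    then show ?thesis using that(1) unfolding d_def by (metis dvd_add_left_iff dvd_triv_right)
  qed
  show ?thesis
    using assms *[of _ f] *[of _ "n - 1 - f"]
    by (intro sum.reindex_bij_witness[where i = "\<lambda>r. p - r" and j = "\<lambda>r. p - r"])
       (auto simp: residue_class_def)
qed

text \<open>Termwise this is the geometric expansion 1/(p - r) = -1/r - p/r^2 modulo p^2.\<close>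

lemma class_sum_reflect:
  assumes "f < n"
  shows "class_sum n (n - 1 - f) + class_sum n f + of_nat p * class_sum2 n f \<in> Ip 2"
proof -
  have "1 / of_nat (p - r) + 1 / of_nat r + of_nat p * (1 / of_nat r ^ 2) \<in> Ip 2"
    if r: "r \<in> residue_class n f" for r
  proof -
    have r: "0 < r" "r < p" using r by (auto simp: residue_class_def)
    have "1 / of_nat (p - r) + 1 / of_nat r + of_nat p * (1 / of_nat r ^ 2)
        = of_nat p ^ 2 * (1 / of_nat r / of_nat r / of_nat (p - r) :: rat)"
      using r by (simp add: of_nat_diff field_simps power2_eq_square)
    also have "\<dots> \<in> Ip 2"
      using r by (intro p_ideal_power divide_less_in_Zp) auto
    finally show ?thesis .
  qed
  then have "(\<Sum>r\<in>residue_class n f. 1 / of_nat (p - r) + 1 / of_nat r + of_nat p * (1 / of_nat r ^ 2)) \<in> Ip 2"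
    by (rule p_ideal_sum)
  then show ?thesis
    unfolding class_sum_def class_sum2_def sum_residue_class_reflect[OF assms]
    by (simp add: sum.distrib sum_distrib_left)
qed

lemma class_sum2_reflect:
  assumes "f < n"
  shows "class_sum2 n (n - 1 - f) - class_sum2 n f \<in> Ip 1"
proof -
  have "1 / of_nat (p - r) ^ 2 - 1 / of_nat r ^ 2 \<in> Ip 1"
    if r: "r \<in> residue_class n f" for r
  proof -
    have r: "0 < r" "r < p" using r by (auto simp: residue_class_def)
    have "1 / of_nat (p - r) ^ 2 - 1 / of_nat r ^ 2
        = of_nat p * ((2 * of_nat r - of_nat p) / of_nat r / of_nat r / of_nat (p - r) / of_nat (p - r) :: rat)"
    proof -
      define y :: rat where "y = of_nat (p - r)"
      have "(of_nat p :: rat) = y + of_nat r" "y \<noteq> 0" using r by (simp_all add: y_def of_nat_diff)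
      with r show ?thesis by (simp add: field_simps power2_eq_square flip: y_def)
    qed
    also have "\<dots> \<in> Ip 1"
      using r by (intro p_ideal_p divide_less_in_Zp p_integers_intros) auto
    finally show ?thesis .
  qed
  then have "(\<Sum>r\<in>residue_class n f. 1 / of_nat (p - r) ^ 2 - 1 / of_nat r ^ 2) \<in> Ip 1"
    by (rule p_ideal_sum)
  then show ?thesis
    unfolding class_sum2_def sum_residue_class_reflect[OF assms]
    by (simp add: sum_subtractf)
qed

section \<open>Fermat quotients as logarithms\<close>

text \<open>The second elementary symmetric function is half the square of the sum minus half the
  sum of squares; everything is doubled to avoid that fraction.\<close>

lemma two_prod_one_plus_p_expansion:
  assumes "finite A" "\<And>i. i \<in> A \<Longrightarrow> x i \<in> Zp"
  shows "2 * (\<Prod>i\<in>A. 1 + of_nat p * x i)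
    - (2 + 2 * of_nat p * (\<Sum>i\<in>A. x i) + of_nat p ^ 2 * ((\<Sum>i\<in>A. x i)\<^sup>2 - (\<Sum>i\<in>A. (x i)\<^sup>2))) \<in> Ip 3"
  using assms
proof (induction A rule: finite_induct)
  case empty
  then show ?case by simp
next
  case (insert i A)
  define Q where "Q = (\<Prod>i\<in>A. 1 + of_nat p * x i)"
  define X where "X = (\<Sum>i\<in>A. x i)"
  define Y where "Y = (\<Sum>i\<in>A. (x i)\<^sup>2)"
  define E where "E = 2 * Q - (2 + 2 * of_nat p * X + of_nat p ^ 2 * (X\<^sup>2 - Y))"
  have E: "E \<in> Ip 3" unfolding E_def Q_def X_def Y_def by (rule insert.IH) (use insert in auto)
  have xi: "x i \<in> Zp" "X \<in> Zp" "Y \<in> Zp"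
    using insert unfolding X_def Y_def by (auto intro!: p_integers_intros)
  have "2 * ((1 + of_nat p * x i) * Q)
      - (2 + 2 * of_nat p * (x i + X) + of_nat p ^ 2 * ((x i + X)\<^sup>2 - ((x i)\<^sup>2 + Y)))
      = (1 + of_nat p * x i) * E + of_nat p ^ 3 * (x i * (X\<^sup>2 - Y))"
    by (simp add: E_def algebra_simps power2_eq_square power3_eq_cube)
  also have "\<dots> \<in> Ip 3"
    using xi E by (intro p_ideal_add p_ideal_lmult[OF _ E] p_ideal_power p_integers_intros) auto
  finally show ?case using insert by (simp add: Q_def X_def Y_def)
qed

text \<open>Modulo \<open>p^2\<close> this is \<open>log (n^(p-1)) / p\<close>, so it turns products of bases into sums.\<close>

definition log_quotient :: "nat \<Rightarrow> rat" where
  "log_quotient n = fermat_quotient p (int n) - of_nat p * (fermat_quotient p (int n))\<^sup>2 / 2"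

text \<open>Each n k equals its remainder r times 1 + p f/r, where f is the quotient. The remainders
  permute 1, ..., p - 1, so their product cancels against that of the k.\<close>

lemma power_eq_prod:
  assumes "coprime n p"
  shows "of_nat n ^ (p - 1) =
    (\<Prod>k\<in>{0<..<p}. 1 + of_nat p * (of_nat (n * k div p) / of_nat (n * k mod p)) :: rat)"
proof -
  have r: "(of_nat (n * k mod p) :: rat) \<noteq> 0" if "k \<in> {0<..<p}" for k
    using mult_mod_p_in[OF assms that] by auto
  have "(of_nat n ^ (p - 1) :: rat) * (\<Prod>k\<in>{0<..<p}. of_nat k) = (\<Prod>k\<in>{0<..<p}. of_nat (n * k))"
    by (simp add: prod.distrib)
  also have "\<dots> = (\<Prod>k\<in>{0<..<p}. of_nat (n * k mod p) *
      (1 + of_nat p * (of_nat (n * k div p) / of_nat (n * k mod p))))"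
  proof (rule prod.cong)
    fix k assume k: "k \<in> {0<..<p}"
    have "of_nat (n * k) = (of_nat (n * k mod p + p * (n * k div p)) :: rat)" by simp
    also have "\<dots> = of_nat (n * k mod p) *
      (1 + of_nat p * (of_nat (n * k div p) / of_nat (n * k mod p)))"
      using r[OF k] unfolding of_nat_add of_nat_mult by (simp add: field_simps)
    finally show "of_nat (n * k) = \<dots>" .
  qed simp
  also have "\<dots> = (\<Prod>k\<in>{0<..<p}. of_nat (n * k mod p)) *
      (\<Prod>k\<in>{0<..<p}. 1 + of_nat p * (of_nat (n * k div p) / of_nat (n * k mod p)))"
    by (rule prod.distrib)
  also have "(\<Prod>k\<in>{0<..<p}. of_nat (n * k mod p) :: rat) = (\<Prod>k\<in>{0<..<p}. of_nat k)"
    by (rule prod.reindex_bij_betw[OF bij_betw_mult_mod_p[OF assms]])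
  finally show ?thesis by simp
qed

text \<open>With X and Y the sums of f/r and of its square, the expanded product gives q = X + p
  (X^2 - Y)/2 modulo p^2. Subtracting p q^2/2 removes X^2 and leaves X - p Y/2, which is then
  grouped by the quotient f.\<close>

lemma log_quotient_expansion:
  assumes n: "n > 0" "coprime n p"
  shows "fermat_quotient p (int n) \<in> Zp"
    and "log_quotient n - ((\<Sum>f<n. of_nat f * class_sum n f)
           - of_nat p * (\<Sum>f<n. of_nat f ^ 2 * class_sum2 n f) / 2) \<in> Ip 2"
proof -
  define x :: "nat \<Rightarrow> rat" where "x k = of_nat (n * k div p) / of_nat (n * k mod p)" for k
  define X where "X = (\<Sum>k\<in>{0<..<p}. x k)"
  define Y where "Y = (\<Sum>k\<in>{0<..<p}. (x k)\<^sup>2)"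
  define q where "q = fermat_quotient p (int n)"
  have x: "x k \<in> Zp" if "k \<in> {0<..<p}" for k
    unfolding x_def using mult_mod_p_in[OF n(2) that] by (intro divide_less_in_Zp) auto
  have XY: "X \<in> Zp" "Y \<in> Zp"
    unfolding X_def Y_def using x by (auto intro!: p_integers_intros)
  have p0: "(of_nat p :: rat) \<noteq> 0" using p_gt_3 by simp
  have "1 + of_nat p * q = (\<Prod>k\<in>{0<..<p}. 1 + of_nat p * x k)"
    using power_eq_prod[OF n(2)] p0 unfolding q_def x_def fermat_quotient_def by simp
  with two_prod_one_plus_p_expansion[of "{0<..<p}" x] x
  have "2 * (1 + of_nat p * q) - (2 + 2 * of_nat p * X + of_nat p ^ 2 * (X\<^sup>2 - Y)) \<in> Ip 3"
    unfolding X_def Y_def by simp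
  then obtain z where z: "z \<in> Zp"
    "2 * (1 + of_nat p * q) - (2 + 2 * of_nat p * X + of_nat p ^ 2 * (X\<^sup>2 - Y)) = of_nat p ^ 3 * z"
    by (rule p_idealE)
  \<comment> \<open>The error z is absorbed into \<open>w\<close>, so that q = X + p w holds
    exactly.\<close>
  define w where "w = (X\<^sup>2 - Y + of_nat p * z) / 2"
  have w: "w \<in> Zp" unfolding w_def using XY z(1) by (intro half_in_Zp p_integers_intros) auto
  have w2: "2 * w = X\<^sup>2 - Y + of_nat p * z" by (simp add: w_def)
  have "2 * of_nat p * q = 2 * of_nat p * X + of_nat p ^ 2 * (2 * w)"
    using z(2) unfolding w2 by (simp add: algebra_simps power2_eq_square power3_eq_cube)
  then have "2 * of_nat p * q = 2 * of_nat p * (X + of_nat p * w)"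
    by (simp add: algebra_simps power2_eq_square)
  then have q: "q = X + of_nat p * w" using p0 by simp
  then show "fermat_quotient p (int n) \<in> Zp"
    using XY w unfolding q_def[symmetric] by (auto intro!: p_integers_intros)
  have "log_quotient n - (X - of_nat p * Y / 2)
      = of_nat p ^ 2 * ((z - 2 * X * w - of_nat p * w\<^sup>2) / 2)"
    unfolding log_quotient_def q_def[symmetric] q
    by (simp add: w_def field_simps power2_eq_square)
  also have "\<dots> \<in> Ip 2"
    using XY z(1) w by (intro p_ideal_power half_in_Zp p_integers_intros) auto
  also have "X = (\<Sum>f<n. of_nat f * class_sum n f)"
    unfolding X_def x_def class_sum_def sum_distrib_left
    by (subst sum_div_mod_eq_sum_residue_class[OF n, of "\<lambda>f r. of_nat f / of_nat r"]) simp
  also have "Y = (\<Sum>f<n. of_nat f ^ 2 * class_sum2 n f)"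
    unfolding Y_def x_def class_sum2_def sum_distrib_left
    by (subst sum_div_mod_eq_sum_residue_class[OF n, of "\<lambda>f r. (of_nat f / of_nat r)\<^sup>2"])
       (simp add: power_divide)
  finally show "log_quotient n - ((\<Sum>f<n. of_nat f * class_sum n f)
           - of_nat p * (\<Sum>f<n. of_nat f ^ 2 * class_sum2 n f) / 2) \<in> Ip 2" .
qed

text \<open>The Fermat quotient of m n is exactly a + b + p a b; the cross term is cancelled by the
  quadratic correction in \<open>log_quotient\<close>.\<close>

lemma log_quotient_mult:
  assumes "m > 0" "coprime m p" "n > 0" "coprime n p"
  shows "log_quotient (m * n) - log_quotient m - log_quotient n \<in> Ip 2"
proof -
  define a where "a = fermat_quotient p (int m)"
  define b where "b = fermat_quotient p (int n)"
  have ab: "a \<in> Zp" "b \<in> Zp"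
    unfolding a_def b_def using assms by (simp_all add: log_quotient_expansion(1))
  have p0: "(of_nat p :: rat) \<noteq> 0" using p_gt_3 by simp
  have "1 + of_nat p * a = of_nat m ^ (p - 1)" "1 + of_nat p * b = of_nat n ^ (p - 1)"
    "1 + of_nat p * fermat_quotient p (int (m * n)) = of_nat m ^ (p - 1) * of_nat n ^ (p - 1)"
    using p0 by (simp_all add: a_def b_def fermat_quotient_def power_mult_distrib)
  then have "1 + of_nat p * fermat_quotient p (int (m * n)) = (1 + of_nat p * a) * (1 + of_nat p * b)"
    by (simp only:)
  then have "of_nat p * fermat_quotient p (int (m * n)) = of_nat p * (a + b + of_nat p * a * b)"
    by (simp add: distrib_left distrib_right)
  then have ab_eq: "fermat_quotient p (int (m * n)) = a + b + of_nat p * a * b" using p0 by simp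
  have "log_quotient (m * n) - log_quotient m - log_quotient n
     = of_nat p ^ 2 * (- (2 * (a + b) * a * b + of_nat p * (a * b)\<^sup>2) / 2)"
    unfolding log_quotient_def ab_eq a_def[symmetric] b_def[symmetric]
    by (simp add: field_simps power2_eq_square)
  also have "\<dots> \<in> Ip 2"
    using ab by (intro p_ideal_power half_in_Zp p_integers_intros) auto
  finally show ?thesis .
qed

section \<open>The last class sums for n = 2, 3, 4, 6\<close>

lemma sum_lessThan_small:
  fixes h :: "nat \<Rightarrow> rat"
  shows "(\<Sum>f<2. h f) = h 0 + h 1"
    "(\<Sum>f<3. h f) = h 0 + h 1 + h 2"
    "(\<Sum>f<4. h f) = h 0 + h 1 + h 2 + h 3"
    "(\<Sum>f<6. h f) = h 0 + h 1 + h 2 + h 3 + h 4 + h 5"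
  by (simp_all add: eval_nat_numeral)

text \<open>The expansion has only the correction p/2 times \<open>class_sum2 2 1\<close>. The two
  sums of inverse squares are congruent modulo p and add up to 0, so both vanish modulo p.\<close>

lemma class_sum_2: "class_sum 2 1 - log_quotient 2 \<in> Ip 2"
proof -
  have A: "log_quotient 2 - (class_sum 2 1 - of_nat p * class_sum2 2 1 / 2) \<in> Ip 2"
    using log_quotient_expansion(2)[of 2] coprime_6 by (simp add: sum_lessThan_small)
  have B: "class_sum2 2 0 + class_sum2 2 1 \<in> Ip 1"
    using sum_class_sum2_in_ideal[of 2] coprime_6 by (simp add: sum_lessThan_small)
  have C: "class_sum2 2 1 - class_sum2 2 0 \<in> Ip 1"
    using class_sum2_reflect[of 0 2] by simp
  have D: "of_nat p * ((class_sum2 2 0 + class_sum2 2 1) + (class_sum2 2 1 - class_sum2 2 0)) \<in> Ip 2"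
    using p_ideal_mult_p[OF p_ideal_add[OF B C]] by (simp add: numeral_2_eq_2)
  have "class_sum 2 1 - log_quotient 2
      = of_nat p * ((class_sum2 2 0 + class_sum2 2 1) + (class_sum2 2 1 - class_sum2 2 0)) / 2 / 2
        - (log_quotient 2 - (class_sum 2 1 - of_nat p * class_sum2 2 1 / 2))"
    by (simp add: algebra_simps)
  also have "\<dots> \<in> Ip 2" by (rule p_ideal_diff[OF half_in_ideal[OF half_in_ideal[OF D]] A])
  finally show ?thesis .
qed

text \<open>Reflection fixes the middle class and so expresses \<open>class_sum 3 1\<close> through
  inverse squares. Writing t for \<open>class_sum2 3\<close>, the total correction is p (t 1 + 2 t
  2), which vanishes modulo p^2 because t 0 = t 2 and t 0 + t 1 + t 2 = 0 modulo p.\<close>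

lemma class_sum_3: "2 * class_sum 3 2 - log_quotient 3 \<in> Ip 2"
proof -
  have A: "log_quotient 3 - (class_sum 3 1 + 2 * class_sum 3 2
      - of_nat p * (class_sum2 3 1 + 4 * class_sum2 3 2) / 2) \<in> Ip 2"
    using log_quotient_expansion(2)[of 3] coprime_6
    by (simp add: sum_lessThan_small)
  have B: "class_sum 3 1 + class_sum 3 1 + of_nat p * class_sum2 3 1 \<in> Ip 2"
    using class_sum_reflect[of 1 3] by simp
  have C: "class_sum2 3 0 + class_sum2 3 1 + class_sum2 3 2 \<in> Ip 1"
    using sum_class_sum2_in_ideal[of 3] coprime_6
    by (simp add: sum_lessThan_small)
  have D: "class_sum2 3 2 - class_sum2 3 0 \<in> Ip 1"
    using class_sum2_reflect[of 0 3] by simp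
  have E: "of_nat p * ((class_sum2 3 0 + class_sum2 3 1 + class_sum2 3 2)
      + (class_sum2 3 2 - class_sum2 3 0)) \<in> Ip 2"
    using p_ideal_mult_p[OF p_ideal_add[OF C D]] by (simp add: numeral_2_eq_2)
  have "2 * class_sum 3 2 - log_quotient 3
      = of_nat p * ((class_sum2 3 0 + class_sum2 3 1 + class_sum2 3 2)
          + (class_sum2 3 2 - class_sum2 3 0))
        - (class_sum 3 1 + class_sum 3 1 + of_nat p * class_sum2 3 1) / 2
        - (log_quotient 3 - (class_sum 3 1 + 2 * class_sum 3 2
            - of_nat p * (class_sum2 3 1 + 4 * class_sum2 3 2) / 2))"
    by (simp add: field_simps)
  also have "\<dots> \<in> Ip 2" by (rule p_ideal_diff[OF p_ideal_diff[OF E half_in_ideal[OF B]] A])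
  finally show ?thesis .
qed

text \<open>A common element would give p f = p g modulo n, where p is invertible.\<close>

lemma residue_class_disjoint:
  assumes "coprime n p" "f < n" "g < n" "f \<noteq> g"
  shows "residue_class n f \<inter> residue_class n g = {}"
proof -
  have False if "n dvd r + p * f" "n dvd r + p * g" for r
  proof -
    have "[r + p * f = r + p * g] (mod n)" using that by (metis cong_0_iff cong_sym cong_trans)
    then have "[p * f = p * g] (mod n)" by (simp add: cong_add_lcancel_nat)
    then have "[f = g] (mod n)"
      using assms(1) by (metis cong_mult_lcancel_nat coprime_commute)
    then show False using assms by (simp add: cong_def)
  qed
  then show ?thesis by (auto simp: residue_class_def)
qed

text \<open>As p is odd, 2 p = 2 modulo 4; an even r + p is divisible by 4 either already or after
  adding 2 p.\<close>

lemma class_sum_2_split_4: "class_sum 2 1 = class_sum 4 1 + class_sum 4 3"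
proof -
  obtain q where q: "p = 2 * q + 1" using odd_p by (elim oddE)
  have "2 dvd r + p \<longleftrightarrow> 4 dvd r + p \<or> 4 dvd r + p * 3" for r unfolding q by presburger
  then have "residue_class 2 1 = residue_class 4 1 \<union> residue_class 4 3"
    by (auto simp: residue_class_def)
  then show ?thesis
    unfolding class_sum_def using residue_class_disjoint[of 4 1 3] coprime_6
    by (simp add: sum.union_disjoint)
qed

text \<open>As 3 does not divide p, the numbers 0, 2 p, 4 p cover all even residues modulo 6, so
  exactly one of them makes an even r + p divisible by 6.\<close>

lemma class_sum_2_split_6: "class_sum 2 1 = class_sum 6 1 + class_sum 6 3 + class_sum 6 5"
proof -
  have "2 dvd r + p \<longleftrightarrow> 6 dvd r + p \<or> 6 dvd r + p * 3 \<or> 6 dvd r + p * 5" for r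
  proof -
    have "\<not> 2 dvd p" "\<not> 3 dvd p"
      using coprime_6(1,2) by (auto dest: coprime_common_divisor_nat)
    then show ?thesis by presburger
  qed
  then have "residue_class 2 1 = residue_class 6 1 \<union> residue_class 6 3 \<union> residue_class 6 5"
    by (auto simp: residue_class_def)
  then show ?thesis
    unfolding class_sum_def
    using residue_class_disjoint[of 6 1 3] residue_class_disjoint[of 6 1 5]
      residue_class_disjoint[of 6 3 5] coprime_6
    by (simp add: sum.union_disjoint Int_Un_distrib2)
qed

lemma class_sum_3_split_6: "class_sum 3 2 = class_sum 6 2 + class_sum 6 5"
proof -
  obtain q where q: "p = 2 * q + 1" using odd_p by (elim oddE)
  have "3 dvd r + p * 2 \<longleftrightarrow> 6 dvd r + p * 2 \<or> 6 dvd r + p * 5" for r unfolding q by presburger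
  then have "residue_class 3 2 = residue_class 6 2 \<union> residue_class 6 5"
    by (auto simp: residue_class_def)
  then show ?thesis
    unfolding class_sum_def using residue_class_disjoint[of 6 2 5] coprime_6
    by (simp add: sum.union_disjoint)
qed

text \<open>A linear system: up to multiples of p, s 1 + 2 s 2 + 3 s 3 = 2 l2 by the expansion for
  4, s 2 = - s 1 by reflection, and s 1 + s 3 = l2 by splitting the odd class modulo 2. The letters
  \<open>A\<close> to \<open>G\<close> are the error terms of the relations used.\<close>

lemma class_sum_4: "4 * class_sum 4 3 - 3 * log_quotient 2 \<in> Ip 2"
proof -
  define s where "s = class_sum 4"
  define t where "t = class_sum2 4"
  define l2 where "l2 = log_quotient 2"
  define l4 where "l4 = log_quotient 4"
  define A where "A = l4 - (s 1 + 2 * s 2 + 3 * s 3 - of_nat p * (t 1 + 4 * t 2 + 9 * t 3) / 2)"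
  define B where "B = s 2 + s 1 + of_nat p * t 1"
  define C where "C = of_nat p * (t 0 + t 1 + t 2 + t 3)"
  define D where "D = of_nat p * (t 3 - t 0)"
  define E where "E = of_nat p * (t 2 - t 1)"
  define F where "F = s 1 + s 3 - l2"
  define G where "G = l4 - l2 - l2"
  have A: "A \<in> Ip 2"
    using log_quotient_expansion(2)[of 4] coprime_6 unfolding A_def s_def t_def l4_def
    by (simp add: sum_lessThan_small)
  have B: "B \<in> Ip 2"
    using class_sum_reflect[of 1 4] unfolding B_def s_def t_def by simp
  have C: "C \<in> Ip 2"
    using p_ideal_mult_p[OF sum_class_sum2_in_ideal[of 4]] coprime_6 unfolding C_def t_def
    by (simp add: sum_lessThan_small numeral_2_eq_2)
  have DE: "D \<in> Ip 2" "E \<in> Ip 2"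
    using p_ideal_mult_p[OF class_sum2_reflect[of 0 4]] p_ideal_mult_p[OF class_sum2_reflect[of 1 4]]
    unfolding D_def E_def t_def by (simp_all add: numeral_2_eq_2)
  have F: "F \<in> Ip 2"
    using class_sum_2 unfolding F_def s_def l2_def class_sum_2_split_4 .
  have G: "G \<in> Ip 2"
    using log_quotient_mult[of 2 2] coprime_6 unfolding G_def l2_def l4_def by simp
  \<comment> \<open>The quotient cancels the inverse squares left by \<open>A\<close> and
    \<open>B\<close>: 9 (C + D) - E = 2 p (5 t 1 + 4 t 2 + 9 t 3).\<close>
  have "4 * s 3 - 3 * l2 = (9 * (C + D) - E) / 2 / 2 + G + F - 2 * B - A"
    unfolding A_def B_def C_def D_def E_def F_def G_def by (simp add: algebra_simps)
  moreover have "(9 * (C + D) - E) / 2 / 2 \<in> Ip 2"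
    by (intro half_in_ideal p_ideal_diff p_ideal_lmult p_ideal_add C DE) simp
  then have "(9 * (C + D) - E) / 2 / 2 + G + F - 2 * B - A \<in> Ip 2"
    by (intro p_ideal_diff p_ideal_lmult[OF _ B] p_ideal_add G F A) auto
  ultimately show ?thesis
    unfolding s_def l2_def by simp
qed

text \<open>The same elimination: up to multiples of p, reflection gives s 4 = - s 1 and s 3 = - s
  2, the splittings give s 1 + s 3 + s 5 = l2 and 2 (s 2 + s 5) = l3, and the expansion for 6
  becomes -3 s 1 - s 2 + 5 s 5 = l2 + l3.\<close>

lemma class_sum_6: "12 * class_sum 6 5 - (4 * log_quotient 2 + 3 * log_quotient 3) \<in> Ip 2"
proof -
  define s where "s = class_sum 6"
  define t where "t = class_sum2 6"
  define l2 where "l2 = log_quotient 2"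
  define l3 where "l3 = log_quotient 3"
  define l6 where "l6 = log_quotient 6"
  define A where "A = l6 - (s 1 + 2 * s 2 + 3 * s 3 + 4 * s 4 + 5 * s 5
      - of_nat p * (t 1 + 4 * t 2 + 9 * t 3 + 16 * t 4 + 25 * t 5) / 2)"
  define B where "B = s 4 + s 1 + of_nat p * t 1"
  define B' where "B' = s 3 + s 2 + of_nat p * t 2"
  define C where "C = of_nat p * (t 0 + t 1 + t 2 + t 3 + t 4 + t 5)"
  define D where "D = of_nat p * (t 5 - t 0)"
  define E where "E = of_nat p * (t 4 - t 1)"
  define E' where "E' = of_nat p * (t 3 - t 2)"
  define F where "F = s 1 + s 3 + s 5 - l2"
  define F' where "F' = 2 * (s 2 + s 5) - l3"
  define G where "G = l6 - l2 - l3"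
  have A: "A \<in> Ip 2"
    using log_quotient_expansion(2)[of 6] coprime_6 unfolding A_def s_def t_def l6_def
    by (simp add: sum_lessThan_small)
  have B: "B \<in> Ip 2" "B' \<in> Ip 2"
    using class_sum_reflect[of 1 6] class_sum_reflect[of 2 6]
    unfolding B_def B'_def s_def t_def by simp_all
  have C: "C \<in> Ip 2"
    using p_ideal_mult_p[OF sum_class_sum2_in_ideal[of 6]] coprime_6 unfolding C_def t_def
    by (simp add: sum_lessThan_small numeral_2_eq_2)
  have DE: "D \<in> Ip 2" "E \<in> Ip 2" "E' \<in> Ip 2"
    using p_ideal_mult_p[OF class_sum2_reflect[of 0 6]] p_ideal_mult_p[OF class_sum2_reflect[of 1 6]]
      p_ideal_mult_p[OF class_sum2_reflect[of 2 6]]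
    unfolding D_def E_def E'_def t_def by (simp_all add: numeral_2_eq_2)
  have F: "F \<in> Ip 2"
    using class_sum_2 unfolding F_def s_def l2_def class_sum_2_split_6 .
  have F': "F' \<in> Ip 2"
    using class_sum_3 unfolding F'_def s_def l3_def class_sum_3_split_6 .
  have G: "G \<in> Ip 2"
    using log_quotient_mult[of 2 3] coprime_6 unfolding G_def l2_def l3_def l6_def by simp
  \<comment> \<open>Here the numerator is 2 p (9 t 1 + 16 t 2 + 9 t 3 + 16 t 4 + 25 t 5), matching
    the inverse squares in \<open>A\<close>, \<open>B\<close> and \<open>B'\<close>.\<close>
  have "12 * s 5 - (4 * l2 + 3 * l3)
      = (25 * (C + D) + 7 * E - 7 * E') / 2 / 2 + G + 3 * F + 2 * F' - 4 * B - 6 * B' - A"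
    unfolding A_def B_def B'_def C_def D_def E_def E'_def F_def F'_def G_def
    by (simp add: algebra_simps)
  moreover have "(25 * (C + D) + 7 * E - 7 * E') / 2 / 2 \<in> Ip 2"
    by (intro half_in_ideal p_ideal_diff p_ideal_lmult p_ideal_add C DE) simp_all
  then have "(25 * (C + D) + 7 * E - 7 * E') / 2 / 2 + G + 3 * F + 2 * F' - 4 * B - 6 * B' - A \<in> Ip 2"
    by (intro p_ideal_diff p_ideal_lmult[OF _ B(1)] p_ideal_lmult[OF _ B(2)] p_ideal_lmult[OF _ F]
        p_ideal_lmult[OF _ F'] p_ideal_add G A) auto
  ultimately show ?thesis
    unfolding s_def l2_def l3_def by simp
qed

section \<open>The harmonic sum modulo the square of p\<close>

lemma prod_in_Zp: "(\<And>i. i \<in> A \<Longrightarrow> f i \<in> Zp) \<Longrightarrow> prod f A \<in> Zp"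
  by (induction A rule: infinite_finite_induct) (auto intro: p_integers_mult)

lemma harmonic_in_Zp: "k < p \<Longrightarrow> harmonic k \<in> Zp"
  unfolding harmonic_def by (intro p_integers_sum divide_less_in_Zp) auto

lemma quad_factor_in_Zp:
  assumes "a \<in> Zp" "0 < j" "j < p"
  shows "1 - a\<^sup>2 / of_nat j ^ 2 \<in> Zp"
proof -
  have "1 - a\<^sup>2 / of_nat j ^ 2 = 1 - a * a / of_nat j / of_nat j" by (simp add: power2_eq_square)
  also have "\<dots> \<in> Zp" using assms by (intro divide_less_in_Zp p_integers_intros) auto
  finally show ?thesis .
qed

lemma quad_prod_in_Zp: "a \<in> Zp \<Longrightarrow> k < p \<Longrightarrow> quad_prod a k \<in> Zp"
  unfolding quad_prod_def by (intro prod_in_Zp quad_factor_in_Zp) auto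

text \<open>For \<open>a = m + p t\<close> the factors \<open>j = m\<close> and \<open>j = p - m\<close> are both divisible by \<open>p\<close>.\<close>

lemma quad_prod_in_ideal:
  assumes t: "t \<in> Zp" and m: "0 < m" "m < p"
  shows "quad_prod (of_nat m + of_nat p * t) (p - 1) \<in> Ip 2"
proof -
  define a where "a = of_nat m + of_nat p * t"
  have a: "a \<in> Zp" unfolding a_def using t by (auto intro!: p_integers_intros)
  define f where "f j = 1 - a\<^sup>2 / of_nat j ^ 2" for j :: nat
  define A where "A = {1..p - 1} - {m} - {p - m}"
  \<comment> \<open>The two factors must be distinct for each to contribute its own p.\<close>
  have ne: "p - m \<noteq> m" using odd_p m by presburger
  have "quad_prod a (p - 1) = f m * prod f ({1..p - 1} - {m})"
    unfolding quad_prod_def f_def[symmetric] using m by (intro prod.remove) auto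
  also have "prod f ({1..p - 1} - {m}) = f (p - m) * prod f A"
    unfolding A_def using m ne by (intro prod.remove) auto
  finally have "quad_prod a (p - 1) = f m * (f (p - m) * prod f A)" .
  moreover have "f m \<in> Ip 1"
  proof -
    have "f m = of_nat p * (- t * (of_nat m + a) / of_nat m / of_nat m)"
      using m by (simp add: f_def a_def field_simps power2_eq_square)
    also have "\<dots> \<in> Ip 1"
      using a t m by (intro p_ideal_p divide_less_in_Zp p_integers_intros) simp_all
    finally show ?thesis .
  qed
  moreover have "f (p - m) \<in> Ip 1"
  proof -
    define x :: rat where "x = of_nat (p - m)"
    have x: "x \<noteq> 0" "(of_nat p :: rat) = x + of_nat m"
      using m by (simp_all add: x_def of_nat_diff)
    have x_Zp: "x \<in> Zp" unfolding x_def by (rule of_nat_in_p_integers)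
    \<comment> \<open>At j = p - m it is x + a, not x - a, that carries the factor p.\<close>
    have "a = of_nat p * (1 + t) - x" unfolding a_def x(2) by (simp add: algebra_simps)
    then have "of_nat p * (1 + t) = x + a" by simp
    have "f (p - m) = (x + a) * (x - a) / x / x"
      using x by (simp add: f_def field_simps power2_eq_square flip: x_def)
    also have "\<dots> = of_nat p * ((1 + t) * (x - a) / x / x)"
      by (simp flip: \<open>of_nat p * (1 + t) = x + a\<close>)
    also have "\<dots> \<in> Ip 1"
      using a t m x_Zp unfolding x_def by (intro p_ideal_p divide_less_in_Zp p_integers_intros) auto
    finally show ?thesis .
  qed
  moreover have "prod f A \<in> Zp"
    unfolding f_def using a by (intro prod_in_Zp quad_factor_in_Zp) (auto simp: A_def)
  ultimately have "quad_prod a (p - 1) \<in> Ip (1 + 1)"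
    by (simp only:) (intro p_ideal_mult p_ideal_rmult)
  then show ?thesis by (simp add: a_def numeral_2_eq_2)
qed

lemma quad_prod_p_mult:
  assumes t: "t \<in> Zp"
  shows "k < p \<Longrightarrow> quad_prod (of_nat p * t) k - 1 \<in> Ip 1"
proof (induction k)
  case (Suc k)
  define Q where "Q = quad_prod (of_nat p * t) k"
  have Q: "Q - 1 \<in> Ip 1" "Q \<in> Zp"
    unfolding Q_def using Suc t by (simp_all add: quad_prod_in_Zp p_integers_mult)
  have "quad_prod (of_nat p * t) (Suc k) - 1
      = (Q - 1) - of_nat p * (of_nat p * t * t * Q / of_nat (Suc k) / of_nat (Suc k))"
    by (simp add: quad_prod_Suc Q_def power2_eq_square field_simps del: of_nat_Suc)
  also have "\<dots> \<in> Ip 1"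
    using Q(2) t Suc.prems
    by (intro p_ideal_diff[OF Q(1)] p_ideal_p divide_less_in_Zp p_integers_intros) (simp_all del: of_nat_Suc)
  finally show ?case .
qed simp

text \<open>In -a (a + k)/k^2 times the product up to k - 1, the prefactor a = p t already supplies
  one p. So a + k may be replaced by k and the product by 1.\<close>

lemma gbinomial_pair_p_mult:
  assumes t: "t \<in> Zp" and k: "0 < k" "k < p"
  shows "gbinomial_pair (of_nat p * t) k + of_nat p * t / of_nat k \<in> Ip 2"
proof -
  obtain l where l: "k = Suc l" using k(1) by (cases k) auto
  define Q where "Q = quad_prod (of_nat p * t) l"
  have Q: "Q - 1 \<in> Ip 1" "Q \<in> Zp"
    unfolding Q_def using k t l quad_prod_p_mult[OF t, of l]
    by (simp_all add: quad_prod_in_Zp p_integers_mult)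
  obtain z where z: "z \<in> Zp" "Q - 1 = of_nat p * z" using Q(1) by (auto elim: p_idealE)
  have "gbinomial_pair (of_nat p * t) k
      = - (of_nat p ^ 2 * (t * t * Q / of_nat k / of_nat k)) - of_nat p * t * Q / of_nat k"
    using k unfolding gbinomial_pair_Suc_eq_quad_prod l Q_def
    by (simp add: field_simps power2_eq_square del: of_nat_Suc)
  also have "Q = 1 + of_nat p * z" using z(2) by simp
  also have "- (of_nat p ^ 2 * (t * t * (1 + of_nat p * z) / of_nat k / of_nat k))
        - of_nat p * t * (1 + of_nat p * z) / of_nat k + of_nat p * t / of_nat k
      = of_nat p ^ 2 * (- (t * t * (1 + of_nat p * z) / of_nat k / of_nat k) - t * z / of_nat k)"
    using k by (simp add: field_simps power2_eq_square)
  also have "\<dots> \<in> Ip 2"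
    using t z k by (intro p_ideal_power divide_less_in_Zp p_integers_intros) auto
  finally show ?thesis .
qed

text \<open>Wolstenholme's theorem, from reflection with n = 1 and the vanishing of the inverse
  squares modulo p.\<close>

lemma class_sum_1_in_ideal: "class_sum 1 0 \<in> Ip 2"
proof -
  have "of_nat p * class_sum2 1 0 \<in> Ip 2"
    using p_ideal_mult_p[OF class_sum2_1_in_ideal] by (simp add: numeral_2_eq_2)
  with class_sum_reflect[of 0 1]
  have "(class_sum 1 0 + class_sum 1 0 + of_nat p * class_sum2 1 0 - of_nat p * class_sum2 1 0) / 2 \<in> Ip 2"
    by (intro half_in_ideal p_ideal_diff) simp_all
  then show ?thesis by simp
qed

text \<open>Twice the sum of 1/(j k) over j \<le> k: the square of the full sum, with the diagonal
  counted once more.\<close>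

lemma two_sum_harmonic_over_index:
  "2 * (\<Sum>k\<in>{0<..N}. harmonic k / of_nat k) = (harmonic N)\<^sup>2 + (\<Sum>k\<in>{0<..N}. 1 / of_nat k ^ 2)"
proof (induction N)
  case (Suc N)
  have "{0<..Suc N} = insert (Suc N) {0<..N}" by auto
  then have "2 * (\<Sum>k\<in>{0<..Suc N}. harmonic k / of_nat k)
      = 2 * (\<Sum>k\<in>{0<..N}. harmonic k / of_nat k) + 2 * harmonic (Suc N) / of_nat (Suc N)"
    "(\<Sum>k\<in>{0<..Suc N}. 1 / of_nat k ^ 2)
      = (\<Sum>k\<in>{0<..N}. 1 / of_nat k ^ 2) + 1 / (of_nat (Suc N) ^ 2 :: rat)"
    by (simp_all add: algebra_simps del: of_nat_Suc)
  then show ?case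
    unfolding Suc.IH harmonic_Suc by (simp add: power2_eq_square field_simps del: of_nat_Suc)
qed simp

lemma interval_p: "{0<..p - Suc 0} = {0<..<p}" "{..p - Suc 0} = insert 0 {0<..<p}"
  using p_gt_3 by auto

lemma harmonic_p: "harmonic (p - Suc 0) = class_sum (Suc 0) 0"
  by (simp add: harmonic_def class_sum_def interval_p)

lemma sum_harmonic_over_index_in_ideal: "(\<Sum>k\<in>{0<..<p}. harmonic k / of_nat k) \<in> Ip 1"
proof -
  have "(class_sum 1 0)\<^sup>2 + class_sum2 1 0 \<in> Ip 1"
  proof (intro p_ideal_add class_sum2_1_in_ideal)
    obtain z where z: "z \<in> Zp" "class_sum 1 0 = of_nat p ^ 2 * z"
      using class_sum_1_in_ideal by (rule p_idealE)
    then have eq: "(class_sum 1 0)\<^sup>2 = of_nat p * (of_nat p ^ 3 * z\<^sup>2)"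
      by (simp add: power2_eq_square power3_eq_cube)
    show "(class_sum 1 0)\<^sup>2 \<in> Ip 1"
      unfolding eq using z(1) by (intro p_ideal_p p_integers_intros) simp_all
  qed
  moreover have "(\<Sum>k\<in>{0<..<p}. harmonic k / of_nat k) = ((class_sum 1 0)\<^sup>2 + class_sum2 1 0) / 2"
    using two_sum_harmonic_over_index[of "p - 1"]
    by (simp add: interval_p harmonic_p class_sum2_def)
  ultimately show ?thesis by (simp only: half_in_ideal)
qed

text \<open>At m = 0 the terms with k > 0 add up to -p t times the sum in Wolstenholme's theorem,
  leaving the term 1. Each step to m + 1 flips the sign, since the two neighbouring sums add up to
  twice a product divisible by p^2.\<close>

lemma pair_sum_cong:
  assumes t: "t \<in> Zp"
  shows "m < p \<Longrightarrow> pair_sum (of_nat m + of_nat p * t) (p - 1) - (-1) ^ m \<in> Ip 2"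
proof (induction m)
  case 0
  have "pair_sum (of_nat p * t) (p - 1) - 1
      = (\<Sum>k\<in>{0<..<p}. gbinomial_pair (of_nat p * t) k + of_nat p * t / of_nat k)
        - of_nat p * t * class_sum 1 0"
    by (simp add: pair_sum_def interval_p sum.distrib class_sum_def sum_distrib_left)
  also have "\<dots> \<in> Ip 2"
    using t by (intro p_ideal_diff p_ideal_sum gbinomial_pair_p_mult p_ideal_lmult
        class_sum_1_in_ideal p_integers_intros) auto
  finally show ?case by simp
next
  case (Suc m)
  define a where "a = of_nat (Suc m) + of_nat p * t"
  have a1: "a - 1 = of_nat m + of_nat p * t" by (simp add: a_def)
  have "pair_sum a (p - 1) - (-1) ^ Suc m
      = 2 * quad_prod a (p - 1) - (pair_sum (a - 1) (p - 1) - (-1) ^ m)"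
    using pair_sum_add_shift[of a "p - 1"] by (simp add: algebra_simps)
  also have "\<dots> \<in> Ip 2"
    using Suc quad_prod_in_ideal[OF t, of "Suc m"] unfolding a1 a_def
    by (intro p_ideal_diff[OF p_ideal_lmult]) simp_all
  finally show ?case unfolding a_def .
qed

lemma pair_harmonic_sum_p_mult:
  assumes t: "t \<in> Zp"
  shows "pair_harmonic_sum (of_nat p * t) (p - 1) \<in> Ip 2"
proof -
  have "pair_harmonic_sum (of_nat p * t) (p - 1)
      = (\<Sum>k\<in>{0<..<p}. (gbinomial_pair (of_nat p * t) k + of_nat p * t / of_nat k) * harmonic k)
        - t * (of_nat p * (\<Sum>k\<in>{0<..<p}. harmonic k / of_nat k))"
    by (simp add: pair_harmonic_sum_def interval_p sum_distrib_left algebra_simps flip: sum_subtractf)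
  also have "\<dots> \<in> Ip 2"
    using t p_ideal_mult_p[OF sum_harmonic_over_index_in_ideal]
    by (intro p_ideal_diff[OF p_ideal_sum[OF p_ideal_rmult] p_ideal_lmult] gbinomial_pair_p_mult
        harmonic_in_Zp) (auto simp: numeral_2_eq_2)
  finally show ?thesis .
qed

text \<open>For a = m - p/n one has 1/a = -n/(p - n m), so each step of the recurrence contributes
  one reciprocal. The bound n m < p keeps every denominator between 0 and p.\<close>

lemma pair_harmonic_sum_cong:
  assumes n: "n > 0" "coprime n p"
  shows "n * m < p \<Longrightarrow> pair_harmonic_sum (of_nat m - of_nat p / of_nat n) (p - 1)
    + 2 * of_nat n * (-1) ^ m * (\<Sum>j\<in>{1..m}. 1 / of_nat (p - n * j)) \<in> Ip 2"
proof (induction m)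
  case 0
  have "- 1 / of_nat n \<in> Zp" using n by (intro p_integers_divide_nat p_integers_minus) auto
  from pair_harmonic_sum_p_mult[OF this] show ?case by simp
next
  case (Suc m)
  define t :: rat where "t = - 1 / of_nat n"
  have t: "t \<in> Zp" unfolding t_def using n by (intro p_integers_divide_nat p_integers_minus) auto
  define a where "a = of_nat (Suc m) - of_nat p / (of_nat n :: rat)"
  define y where "y = p - n * Suc m"
  have at: "a = of_nat (Suc m) + of_nat p * t" and at1: "a - 1 = of_nat m + of_nat p * t"
    and a1: "a - 1 = of_nat m - of_nat p / of_nat n"
    by (simp_all add: a_def t_def)
  have y: "0 < y" "y < p" using Suc.prems n by (simp_all add: y_def)
  have mp: "Suc m < p" "m < p" "n * m < p"
  proof -
    have "1 * Suc m \<le> n * Suc m" using n by (intro mult_le_mono1) auto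
    then show "Suc m < p" "m < p" using Suc.prems by simp_all
    show "n * m < p" using Suc.prems by simp
  qed
  have a: "a * of_nat n = - of_nat y"
    using Suc.prems n by (simp add: a_def y_def of_nat_diff field_simps)
  then have a0: "a \<noteq> 0" using y n by auto
  have ia: "1 / a = - of_nat n / of_nat y"
    using a a0 y n by (simp add: field_simps)
  define \<Sigma> where "\<Sigma> = (\<Sum>j\<in>{1..m}. 1 / of_nat (p - n * j) :: rat)"
  define Q where "Q = quad_prod a (p - 1)"
  define H where "H = harmonic (p - 1)"
  have "pair_harmonic_sum a (p - 1) + pair_harmonic_sum (a - 1) (p - 1)
      = 2 * Q * H + (pair_sum a (p - 1) - pair_sum (a - 1) (p - 1)) * (1 / a)"
    using pair_harmonic_sum_add_shift[of a "p - 1"] a0 unfolding Q_def H_def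
    by (simp add: field_simps)
  \<comment> \<open>The right side is arranged so that every summand has a factor already known to
    be divisible by p^2.\<close>
  then have "pair_harmonic_sum a (p - 1) + 2 * of_nat n * (-1) ^ Suc m * (\<Sigma> + 1 / of_nat y)
    = 2 * H * Q - ((pair_sum a (p - 1) - (-1) ^ Suc m)
          - (pair_sum (a - 1) (p - 1) - (-1) ^ m)) * (of_nat n / of_nat y)
      - (pair_harmonic_sum (a - 1) (p - 1) + 2 * of_nat n * (-1) ^ m * \<Sigma>)"
    unfolding ia by (simp add: algebra_simps)
  also have "\<dots> \<in> Ip 2"
  proof (rule p_ideal_diff[OF p_ideal_diff[OF p_ideal_lmult p_ideal_rmult[OF p_ideal_diff]]])
    show "Q \<in> Ip 2" unfolding Q_def at by (rule quad_prod_in_ideal[OF t]) (use mp in auto)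
    show "2 * H \<in> Zp"
      unfolding H_def using p_gt_3 by (intro p_integers_mult harmonic_in_Zp) auto
    show "pair_sum a (p - 1) - (-1) ^ Suc m \<in> Ip 2"
      unfolding at by (rule pair_sum_cong[OF t mp(1)])
    show "pair_sum (a - 1) (p - 1) - (-1) ^ m \<in> Ip 2"
      unfolding at1 by (rule pair_sum_cong[OF t mp(2)])
    show "of_nat n / of_nat y \<in> Zp" using y by (intro divide_less_in_Zp) auto
    show "pair_harmonic_sum (a - 1) (p - 1) + 2 * of_nat n * (-1) ^ m * \<Sigma> \<in> Ip 2"
      unfolding a1 \<Sigma>_def by (rule Suc.IH[OF mp(3)])
  qed
  finally show ?case by (simp add: a_def \<Sigma>_def y_def)
qed

section \<open>Specialisation to a = -1/n\<close>

lemma mult_neq_p: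
  assumes "n > 1" "coprime n p"
  shows "n * k \<noteq> p"
  using assms coprime_common_divisor_nat[of n p n] by auto

text \<open>For f = n - 1 the class condition says that n divides p - r, so r = p - n j; as n j is
  never p, the index runs up to p div n with r > 0.\<close>

lemma class_sum_last:
  assumes n: "n > 1" "coprime n p"
  shows "class_sum n (n - 1) = (\<Sum>j\<in>{1..p div n}. 1 / of_nat (p - n * j))"
  unfolding class_sum_def
proof (rule sum.reindex_bij_witness[where i = "\<lambda>j. p - n * j" and j = "\<lambda>r. (p - r) div n"])
  have dvd: "n dvd r + p * (n - 1) \<longleftrightarrow> n dvd p - r" if "r < p" for r
  proof -
    obtain q where q: "n = Suc q" using n by (cases n) auto
    have "(r + p * (n - 1)) + (p - r) = n * p" using that by (simp add: q)
    then show ?thesis by (metis dvd_add_right_iff dvd_add_left_iff dvd_triv_left)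
  qed
  fix r assume "r \<in> residue_class n (n - 1)"
  then have "0 < r" "r < p" "n dvd r + p * (n - 1)" unfolding residue_class_def by auto
  then have r: "0 < r" "r < p" "n dvd p - r" by (simp_all only: dvd)
  then obtain j where j: "p - r = n * j" by (elim dvdE)
  have d: "(p - r) div n = j" using n by (simp add: j)
  have "j > 0" using r j by (metis gr0I less_numeral_extra(3) mult_0_right zero_less_diff)
  moreover have "j \<le> p div n"
    using n j by (metis d div_le_mono diff_le_self)
  ultimately show "(p - r) div n \<in> {1..p div n}" by (simp add: d)
  have *: "p - n * ((p - r) div n) = r" unfolding d j[symmetric] using r by simp
  show "p - n * ((p - r) div n) = r" by (rule *)
  show "1 / of_nat (p - n * ((p - r) div n)) = (1 / of_nat r :: rat)" unfolding * ..
next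
  fix j assume j: "j \<in> {1..p div n}"
  have "n * j \<le> p" using j n by (metis atLeastAtMost_iff div_times_less_eq_dividend le_trans mult.commute mult_le_mono2)
  moreover have "n * j \<noteq> p" by (rule mult_neq_p[OF n(1,2)])
  ultimately have nj: "n * j < p" by simp
  then show "(p - (p - n * j)) div n = j" using n by simp
  have "(p - n * j) + p * (n - 1) + n * j = p * n" using nj n by (cases n) (simp_all add: algebra_simps)
  then have "n dvd (p - n * j) + p * (n - 1)" by (metis dvd_add_left_iff dvd_triv_left dvd_triv_right)
  then show "p - n * j \<in> residue_class n (n - 1)"
    using nj j n by (simp add: residue_class_def)
qed

text \<open>With m = p div n, m - p/n = -(p mod n)/n is -1/n or -1 + 1/n. The symmetry a -> -1 - a
  exchanges these two values.\<close>

lemma pair_harmonic_sum_minus_inverse: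
  assumes n: "n > 1" "coprime n p" "p mod n = 1 \<or> p mod n = n - 1"
  shows "pair_harmonic_sum (- 1 / of_nat n) (p - 1)
    + 2 * of_nat n * (-1) ^ (p div n) * class_sum n (n - 1) \<in> Ip 2"
proof -
  have "n * (p div n) \<noteq> p" by (rule mult_neq_p[OF n(1,2)])
  then have "n * (p div n) < p" by (simp add: order_less_le)
  moreover have "pair_harmonic_sum (of_nat (p div n) - of_nat p / of_nat n) N
      = pair_harmonic_sum (- 1 / of_nat n) N" for N
  proof -
    define b :: rat where "b = - 1 / of_nat n"
    have "(of_nat p :: rat) = of_nat n * of_nat (p div n) + of_nat (p mod n)"
      by (simp flip: of_nat_mult of_nat_add)
    then have "of_nat (p div n) - of_nat p / of_nat n = - of_nat (p mod n) / (of_nat n :: rat)"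
      using n by (simp add: field_simps)
    also have "\<dots> = b \<or> \<dots> = - 1 - b"
      using n by (auto simp: b_def of_nat_diff field_simps)
    finally show ?thesis
      unfolding pair_harmonic_sum_def b_def[symmetric]
      by (auto simp: gbinomial_pair_def mult.commute)
  qed
  ultimately show ?thesis
    using pair_harmonic_sum_cong[of n "p div n"] n(1,2) unfolding class_sum_last[OF n(1,2)] by simp
qed

section \<open>Legendre symbols\<close>

text \<open>Such values differ by at most 2, which is less than p.\<close>

lemma sign_eqI:
  assumes "[x = y] (mod int p)" "x \<in> {-1, 0, 1}" "y \<in> {-1, 1}"
  shows "x = y"
proof (rule ccontr)
  assume "x \<noteq> y"
  then have "int p \<le> \<bar>x - y\<bar>"
    using assms(1) dvd_imp_le_int[of "x - y" "int p"] by (simp add: cong_iff_dvd_diff)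
  then show False using assms(2,3) p_gt_3 by auto
qed

lemma Legendre_minus_1: "Legendre (- 1) (int p) = (- 1) ^ (p div 2)"
proof -
  have "[Legendre (- 1) (int p) = (- 1) ^ ((p - 1) div 2)] (mod int p)"
    using euler_criterion[OF prime_p] p_gt_3 by simp
  also have "(p - 1) div 2 = p div 2" using odd_p by presburger
  finally show ?thesis
    by (rule sign_eqI) (auto simp: Legendre_def minus_one_power_iff)
qed

text \<open>Gauss's lemma: with h = (p - 1)/2, the doubles of 1, ..., h stay below p without
  reduction, and those exceeding h come from x > h div 2.\<close>

lemma Legendre_2: "Legendre 2 (int p) = (- 1) ^ (p div 2 - p div 4)"
proof -
  have "\<not> [2 = 0] (mod int p)" using p_gt_3 by (auto simp: cong_0_iff dest!: zdvd_imp_le)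
  then interpret GAUSS p 2 using prime_p p_gt_3 by unfold_locales auto
  define h where "h = (int p - 1) div 2"
  obtain q where q: "p = 2 * q + 1" using odd_p by (elim oddE)
  have h: "h = int q" by (simp add: h_def q)
  have C: "C = (\<lambda>x. x * 2) ` {0<..h}"
    unfolding C_def B_def A_def h_def[symmetric] image_image
    by (intro image_cong) (auto simp: h q)
  have "E = (\<lambda>x. x * 2) ` {h div 2<..h}"
    unfolding E_def C h_def[symmetric] by (auto simp: h)
  then have "card E = nat (h - h div 2)" by (simp add: card_image inj_on_def)
  also have "h - h div 2 = int (q - q div 2)" by (simp add: h of_nat_diff zdiv_int)
  also have "nat (int (q - q div 2)) = p div 2 - p div 4"
  proof -
    have "(2 * q + 1) div 2 = q" "(2 * q + 1) div 4 = q div 2" by presburger+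
    then show ?thesis by (simp only: q nat_int)
  qed
  finally show ?thesis using gauss_lemma by simp
qed

lemma Legendre_minus_2: "Legendre (- 2) (int p) = (- 1) ^ (p div 4)"
proof -
  have p2: "2 < p" using p_gt_3 by simp
  have "[Legendre (- 2) (int p) = (- 2) ^ ((p - 1) div 2)] (mod int p)"
    by (rule euler_criterion[OF prime_p p2])
  also have "(- 2) ^ ((p - 1) div 2) = (- 1) ^ ((p - 1) div 2) * (2 :: int) ^ ((p - 1) div 2)"
    by (simp flip: power_mult_distrib)
  also have "[\<dots> = Legendre (- 1) (int p) * Legendre 2 (int p)] (mod int p)"
    by (intro cong_mult cong_sym[OF euler_criterion[OF prime_p p2]])
  also have "Legendre (- 1) (int p) * Legendre 2 (int p) = (- 1) ^ (p div 2 + (p div 2 - p div 4))"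
    unfolding Legendre_minus_1 Legendre_2 by (simp only: power_add)
  also have "(- 1 :: int) ^ (p div 2 + (p div 2 - p div 4)) = (- 1) ^ (p div 4)"
  proof -
    have "p div 4 \<le> p div 2" by (simp add: div_le_mono2)
    then have "even (p div 2 + (p div 2 - p div 4)) \<longleftrightarrow> even (p div 4)" by auto
    then show ?thesis unfolding minus_one_power_iff by simp
  qed
  finally show ?thesis
    by (rule sign_eqI) (auto simp: Legendre_def minus_one_power_iff)
qed

lemma p_mod_6: "p mod 6 = 1 \<or> p mod 6 = 5"
proof -
  have "\<not> 2 dvd p" "\<not> 3 dvd p"
    using coprime_6(1,2) by (auto dest: coprime_common_divisor_nat)
  then show ?thesis by presburger
qed

text \<open>The only nonzero square modulo 3 is 1, and p = 6 q + 1 or 6 q + 5 gives p div 3 = 2 q or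
  2 q + 1.\<close>

lemma Legendre_3: "Legendre (int p) 3 = (- 1) ^ (p div 3)"
proof -
  have "QuadRes 3 (int p) \<longleftrightarrow> int p mod 3 = 1" if "int p mod 3 = 1 \<or> int p mod 3 = 2"
  proof -
    have "y\<^sup>2 mod 3 \<noteq> 2" for y :: int
    proof -
      have "y\<^sup>2 mod 3 = (y mod 3)\<^sup>2 mod 3" by (simp add: power_mod)
      moreover have "y mod 3 = 0 \<or> y mod 3 = 1 \<or> y mod 3 = 2" by presburger
      ultimately show ?thesis by auto
    qed
    moreover have "[1\<^sup>2 = int p] (mod 3)" if "int p mod 3 = 1" using that by (simp add: cong_def)
    ultimately show ?thesis using that unfolding QuadRes_def cong_def by metis
  qed
  moreover have "int p mod 3 = 1 \<and> even (p div 3) \<or> int p mod 3 = 2 \<and> odd (p div 3)"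
    using p_mod_6 by presburger
  ultimately show ?thesis by (auto simp: Legendre_def cong_def)
qed

text \<open>For p = 6 q + 1 or 6 q + 5, p div 2 is 3 q or 3 q + 2. This identifies the sign for n =
  6 with the Legendre symbol of -1.\<close>

lemma even_div_2_iff_even_div_6: "even (p div 2) \<longleftrightarrow> even (p div 6)"
  using p_mod_6 by presburger

lemma fermat_quotient_in_Zp: "fermat_quotient p 2 \<in> Zp" "fermat_quotient p 3 \<in> Zp"
  using log_quotient_expansion(1)[of 2] log_quotient_expansion(1)[of 3] coprime_6 by simp_all

end

section \<open>The four binomial products\<close>

lemma gbinomial_pair_minus_inverse_Suc:
  assumes "n > 0"
  shows "gbinomial_pair (- 1 / of_nat n) (Suc k) = gbinomial_pair (- 1 / of_nat n) k *
    ((of_nat n * of_nat k + 1) * (of_nat n * of_nat k + of_nat n - 1))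
     / (of_nat n * (of_nat k + 1)) ^ 2"
proof -
  define x :: rat where "x = of_nat n"
  define y :: rat where "y = of_nat k"
  have x: "x \<noteq> 0" using assms by (simp add: x_def)
  have "gbinomial_pair (- 1 / x) (Suc k) =
      gbinomial_pair (- 1 / x) k * (y * (y + 1) - - 1 / x * (- 1 / x + 1)) / (y + 1) ^ 2"
    unfolding gbinomial_pair_Suc y_def by (simp add: add.commute)
  also have "y * (y + 1) - - 1 / x * (- 1 / x + 1) = (x * y + 1) * (x * y + x - 1) / x ^ 2"
    using x by (simp add: field_simps power2_eq_square)
  finally show ?thesis by (simp add: power_mult_distrib x_def y_def)
qed

text \<open>A closed form is determined by its initial value and the ratio of consecutive
  terms.\<close>

lemma gbinomial_pair_minus_inverse_eqI:
  assumes "n > 0" "c 0 = 1"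
    and "\<And>k. c (Suc k) * (of_nat n * (of_nat k + 1)) ^ 2 =
      c k
      * ((of_nat n * of_nat k + 1) * (of_nat n * of_nat k + of_nat n - 1))"
  shows "gbinomial_pair (- 1 / of_nat n) k = c k"
proof (induction k)
  case (Suc k)
  have "(of_nat n * (of_nat k + 1)) ^ 2 \<noteq> (0 :: rat)"
    using assms(1) by (simp flip: of_nat_Suc add: add.commute)
  then show ?case
    unfolding gbinomial_pair_minus_inverse_Suc[OF assms(1)] Suc.IH assms(3)[of k, symmetric]
    by (rule nonzero_mult_div_cancel_right)
qed (simp add: assms)

lemma binomial_2: "of_nat ((2 * k) choose k) = (fact (2 * k) / fact k ^ 2 :: rat)"
  by (simp add: binomial_fact power2_eq_square)

lemma binomial_23:
  "of_nat (((2 * k) choose k) * ((3 * k) choose k)) = (fact (3 * k) / fact k ^ 3 :: rat)"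
  by (simp add: binomial_fact power3_eq_cube)

lemma binomial_42:
  "of_nat (((4 * k) choose (2 * k)) * ((2 * k) choose k)) =
     (fact (4 * k) / (fact (2 * k) * fact k ^ 2) :: rat)"
  by (simp add: binomial_fact power2_eq_square)

lemma binomial_63:
  "of_nat (((6 * k) choose (3 * k)) * ((3 * k) choose k)) =
     (fact (6 * k) / (fact (3 * k) * fact (2 * k) * fact k) :: rat)"
  by (simp add: binomial_fact)

text \<open>Constants are pulled out of the linear factors so that common ones cancel in quotients;
  for instance 72 = 6 * 2 * 3 * 2 comes from 6 x + 6, 6 x + 4, 6 x + 3 and 6 x + 2.\<close>

lemma fact_mult_Suc:
  fixes k :: nat
  defines "x \<equiv> of_nat k :: rat"
  shows "fact (Suc k) = (x + 1) * fact k"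
    "fact (2 * Suc k) = 2 * (x + 1) * (2 * x + 1) * fact (2 * k)"
    "fact (3 * Suc k) = 3 * (x + 1) * (3 * x + 2) * (3 * x + 1) * fact (3 * k)"
    "fact (4 * Suc k) = 8 * (x + 1) * (4 * x + 3) * (2 * x + 1) * (4 * x + 1) * fact (4 * k)"
    "fact (6 * Suc k) = 72 * (x + 1) * (6 * x + 5) * (3 * x + 2) * (2 * x + 1) * (3 * x + 1) * (6 * x + 1)
       * fact (6 * k)"
proof -
  have *: "fact (n + 2) = (of_nat n + 2) * (of_nat n + 1) * (fact n :: rat)"
    "fact (n + 3) = (of_nat n + 3) * (of_nat n + 2) * (of_nat n + 1) * (fact n :: rat)"
    "fact (n + 4) = (of_nat n + 4) * (of_nat n + 3) * (of_nat n + 2) * (of_nat n + 1) * (fact n :: rat)"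
    "fact (n + 6) = (of_nat n + 6) * (of_nat n + 5) * (of_nat n + 4) * (of_nat n + 3) * (of_nat n + 2)
       * (of_nat n + 1) * (fact n :: rat)" for n
    by (simp_all add: eval_nat_numeral add_ac mult_ac)
  have "2 * Suc k = 2 * k + 2" "3 * Suc k = 3 * k + 3" "4 * Suc k = 4 * k + 4" "6 * Suc k = 6 * k + 6"
    by simp_all
  then show "fact (Suc k) = (x + 1) * fact k"
    "fact (2 * Suc k) = 2 * (x + 1) * (2 * x + 1) * fact (2 * k)"
    "fact (3 * Suc k) = 3 * (x + 1) * (3 * x + 2) * (3 * x + 1) * fact (3 * k)"
    "fact (4 * Suc k) = 8 * (x + 1) * (4 * x + 3) * (2 * x + 1) * (4 * x + 1) * fact (4 * k)"
    "fact (6 * Suc k) = 72 * (x + 1) * (6 * x + 5) * (3 * x + 2) * (2 * x + 1) * (3 * x + 1) * (6 * x + 1)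
       * fact (6 * k)"
    by (simp_all only: *) (simp_all add: x_def algebra_simps)
qed

text \<open>Here and for n = 3, 4, 6, the ratio of consecutive binomial products is C (n k + 1) (n k
  + n - 1)/(k + 1)^2 with C = 4, 3, 4, 12. The base of the power is C n^2, that is 16, 27, 64,
  432.\<close>

lemma gbinomial_pair_minus_inverse_2:
  "gbinomial_pair (- 1 / of_nat 2) k = of_nat (((2 * k) choose k) ^ 2) / 16 ^ k"
  unfolding of_nat_power binomial_2
proof (rule gbinomial_pair_minus_inverse_eqI)
  fix k :: nat
  \<comment> \<open>Naming the linear factors makes them cancel as atoms instead of being multiplied
    out.\<close>
  define a :: rat where "a = of_nat k + 1"
  define b :: rat where "b = 2 * of_nat k + 1"
  have nz: "a \<noteq> 0" "b \<noteq> 0"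
    using of_nat_0_le_iff[of k, where 'a = rat] unfolding a_def b_def by linarith+
  have e: "(of_nat 2 * of_nat k + 1 :: rat) = b" "(of_nat 2 * of_nat k + of_nat 2 - 1 :: rat) = b"
    by (simp_all add: a_def b_def)
  show "(fact (2 * (Suc k)) / fact (Suc k) ^ 2) ^ 2 / 16 ^ (Suc k)
      * (of_nat 2 * (of_nat k + 1)) ^ 2
    = (fact (2 * k) / fact k ^ 2) ^ 2 / 16 ^ k
      * ((of_nat 2 * of_nat k + 1) * (of_nat 2 * of_nat k + of_nat 2 - 1) :: rat)"
    unfolding e fact_mult_Suc a_def[symmetric] b_def[symmetric]
    using nz by (simp add: field_simps power2_eq_square power3_eq_cube)
qed simp_all

lemma gbinomial_pair_minus_inverse_3:
  "gbinomial_pair (- 1 / of_nat 3) k = of_nat (((2 * k) choose k) * ((3 * k) choose k)) / 27 ^ k"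
  unfolding of_nat_power binomial_23
proof (rule gbinomial_pair_minus_inverse_eqI)
  fix k :: nat
  define a :: rat where "a = of_nat k + 1"
  define c :: rat where "c = 3 * of_nat k + 1"
  define d :: rat where "d = 3 * of_nat k + 2"
  have nz: "a \<noteq> 0" "c \<noteq> 0" "d \<noteq> 0"
    using of_nat_0_le_iff[of k, where 'a = rat] unfolding a_def c_def d_def by linarith+
  have e: "(of_nat 3 * of_nat k + 1 :: rat) = c" "(of_nat 3 * of_nat k + of_nat 3 - 1 :: rat) = d"
    by (simp_all add: a_def c_def d_def)
  show "fact (3 * (Suc k)) / fact (Suc k) ^ 3 / 27 ^ (Suc k)
      * (of_nat 3 * (of_nat k + 1)) ^ 2
    = fact (3 * k) / fact k ^ 3 / 27 ^ k
      * ((of_nat 3 * of_nat k + 1) * (of_nat 3 * of_nat k + of_nat 3 - 1) :: rat)"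
    unfolding e fact_mult_Suc a_def[symmetric] c_def[symmetric] d_def[symmetric]
    using nz by (simp add: field_simps power2_eq_square power3_eq_cube)
qed simp_all

lemma gbinomial_pair_minus_inverse_4:
  "gbinomial_pair (- 1 / of_nat 4) k = of_nat (((4 * k) choose (2 * k)) * ((2 * k) choose k)) / 64 ^ k"
  unfolding of_nat_power binomial_42
proof (rule gbinomial_pair_minus_inverse_eqI)
  fix k :: nat
  define a :: rat where "a = of_nat k + 1"
  define b :: rat where "b = 2 * of_nat k + 1"
  define c :: rat where "c = 4 * of_nat k + 1"
  define d :: rat where "d = 4 * of_nat k + 3"
  have nz: "a \<noteq> 0" "b \<noteq> 0" "c \<noteq> 0" "d \<noteq> 0"
    using of_nat_0_le_iff[of k, where 'a = rat] unfolding a_def b_def c_def d_def by linarith+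
  have e: "(of_nat 4 * of_nat k + 1 :: rat) = c" "(of_nat 4 * of_nat k + of_nat 4 - 1 :: rat) = d"
    by (simp_all add: a_def b_def c_def d_def)
  show "fact (4 * (Suc k)) / (fact (2 * (Suc k)) * fact (Suc k) ^ 2) / 64 ^ (Suc k)
      * (of_nat 4 * (of_nat k + 1)) ^ 2
    = fact (4 * k) / (fact (2 * k) * fact k ^ 2) / 64 ^ k
      * ((of_nat 4 * of_nat k + 1) * (of_nat 4 * of_nat k + of_nat 4 - 1) :: rat)"
    unfolding e fact_mult_Suc a_def[symmetric] b_def[symmetric] c_def[symmetric] d_def[symmetric]
    using nz by (simp add: field_simps power2_eq_square power3_eq_cube)
qed simp_all

lemma gbinomial_pair_minus_inverse_6:
  "gbinomial_pair (- 1 / of_nat 6) k = of_nat (((6 * k) choose (3 * k)) * ((3 * k) choose k)) / 432 ^ k"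
  unfolding of_nat_power binomial_63
proof (rule gbinomial_pair_minus_inverse_eqI)
  fix k :: nat
  define a :: rat where "a = of_nat k + 1"
  define b :: rat where "b = 2 * of_nat k + 1"
  define c :: rat where "c = 3 * of_nat k + 1"
  define d :: rat where "d = 3 * of_nat k + 2"
  define u :: rat where "u = 6 * of_nat k + 1"
  define v :: rat where "v = 6 * of_nat k + 5"
  have nz: "a \<noteq> 0" "b \<noteq> 0" "c \<noteq> 0" "d \<noteq> 0" "u \<noteq> 0" "v \<noteq> 0"
    using of_nat_0_le_iff[of k, where 'a = rat] unfolding a_def b_def c_def d_def u_def v_def by linarith+
  have e: "(of_nat 6 * of_nat k + 1 :: rat) = u" "(of_nat 6 * of_nat k + of_nat 6 - 1 :: rat) = v"
    by (simp_all add: a_def b_def c_def d_def u_def v_def)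
  show "fact (6 * (Suc k)) / (fact (3 * (Suc k)) * fact (2 * (Suc k)) * fact (Suc k)) / 432 ^ (Suc k)
      * (of_nat 6 * (of_nat k + 1)) ^ 2
    = fact (6 * k) / (fact (3 * k) * fact (2 * k) * fact k) / 432 ^ k
      * ((of_nat 6 * of_nat k + 1) * (of_nat 6 * of_nat k + of_nat 6 - 1) :: rat)"
    unfolding e fact_mult_Suc a_def[symmetric] b_def[symmetric] c_def[symmetric]
      d_def[symmetric] u_def[symmetric] v_def[symmetric]
    using nz by (simp add: field_simps power2_eq_square power3_eq_cube)
qed simp_all

section \<open>Assembly of the four congruences\<close>

context prime_gt_3
begin

lemma signed_sum_pcong:
  assumes n: "n > 1" "coprime n p" "p mod n = 1 \<or> p mod n = n - 1"
    and u: "\<And>k. u k = gbinomial_pair (- 1 / of_nat n) k"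
    and L: "L = (- 1) ^ (p div n)"
    and K: "2 * of_nat n * class_sum n (n - 1) + z \<in> Ip 2" and z: "z \<in> Zp"
  shows "pcong p 2 (of_int L * (\<Sum>k = 0..p - 1. u k * harmonic k)) z"
proof (rule pcongI[OF z])
  define T where "T = pair_harmonic_sum (- 1 / of_nat n) (p - 1)"
  define c where "c = 2 * of_nat n * class_sum n (n - 1)"
  have s: "of_int L * of_int L = (1 :: rat)" unfolding L by (simp flip: power_add mult_2)
  have sum: "(\<Sum>k = 0..p - 1. u k * harmonic k) = T"
    by (simp add: T_def pair_harmonic_sum_def u atLeast0AtMost)
  \<comment> \<open>Since L^2 = 1, multiplying by the sign L removes the sign from the evaluation of
    T.\<close>
  have diff: "of_int L * T - z = of_int L * (T + of_int L * c) - (c + z)"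
    using s by (simp add: algebra_simps flip: mult.assoc)
  have "T + of_int L * c \<in> Ip 2"
    using pair_harmonic_sum_minus_inverse[OF n] unfolding T_def c_def L by (simp add: mult_ac)
  then show "of_int L * (\<Sum>k = 0..p - 1. u k * harmonic k) - z \<in> Ip 2"
    unfolding sum diff using K unfolding c_def by (intro p_ideal_diff[OF p_ideal_lmult]) simp_all
qed

lemma class_sum_log_quotient:
  "2 * of_nat 2 * class_sum 2 (2 - 1) + - 4 * log_quotient 2 \<in> Ip 2"
  "2 * of_nat 3 * class_sum 3 (3 - 1) + - 3 * log_quotient 3 \<in> Ip 2"
  "2 * of_nat 4 * class_sum 4 (4 - 1) + - 6 * log_quotient 2 \<in> Ip 2"
  "2 * of_nat 6 * class_sum 6 (6 - 1) + (- 3 * log_quotient 3 - 4 * log_quotient 2) \<in> Ip 2"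
  \<comment> \<open>The multipliers are the numerals 4, 3 and 2; they turn the coefficients of the
    class sums into 2 n.\<close>
  using p_ideal_lmult[OF numeral_in_p_integers class_sum_2, of "Num.Bit0 (Num.Bit0 Num.One)"]
    p_ideal_lmult[OF numeral_in_p_integers class_sum_3, of "Num.Bit1 Num.One"]
    p_ideal_lmult[OF numeral_in_p_integers class_sum_4, of "Num.Bit0 Num.One"] class_sum_6
  by (simp_all add: algebra_simps)

end

theorem corollary1p1:
  fixes p :: nat
  assumes "prime p" and "p > 3"
  shows
    "pcong p 2
       (of_int (Legendre (- 1) (int p)) *
         (\<Sum>k = 0..p - 1. of_nat (((2 * k) choose k) ^ 2) / 16 ^ k * harmonic k))
       (- 4 * fermat_quotient p 2 + 2 * of_nat p * (fermat_quotient p 2)\<^sup>2)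
   \<and> pcong p 2
       (of_int (Legendre (int p) 3) *
         (\<Sum>k = 0..p - 1. of_nat (((2 * k) choose k) * ((3 * k) choose k)) / 27 ^ k * harmonic k))
       (- 3 * fermat_quotient p 3 + 3 / 2 * of_nat p * (fermat_quotient p 3)\<^sup>2)
   \<and> pcong p 2
       (of_int (Legendre (- 2) (int p)) *
         (\<Sum>k = 0..p - 1. of_nat (((4 * k) choose (2 * k)) * ((2 * k) choose k)) / 64 ^ k * harmonic k))
       (- 6 * fermat_quotient p 2 + 3 * of_nat p * (fermat_quotient p 2)\<^sup>2)
   \<and> pcong p 2
       (of_int (Legendre (- 1) (int p)) *
         (\<Sum>k = 0..p - 1. of_nat (((6 * k) choose (3 * k)) * ((3 * k) choose k)) / 432 ^ k * harmonic k))
       (- 3 * fermat_quotient p 3 - 4 * fermat_quotient p 2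
         + of_nat p * (3 / 2 * (fermat_quotient p 3)\<^sup>2 + 2 * (fermat_quotient p 2)\<^sup>2))"
proof -
  interpret prime_gt_3 p using assms by unfold_locales
  \<comment> \<open>Each right-hand side is exactly a combination of q - p q^2/2 for q the Fermat
    quotients of 2 and 3.\<close>
  have rhs: "- 4 * fermat_quotient p 2 + 2 * of_nat p * (fermat_quotient p 2)\<^sup>2 = - 4 * log_quotient 2"
    "- 3 * fermat_quotient p 3 + 3 / 2 * of_nat p * (fermat_quotient p 3)\<^sup>2 = - 3 * log_quotient 3"
    "- 6 * fermat_quotient p 2 + 3 * of_nat p * (fermat_quotient p 2)\<^sup>2 = - 6 * log_quotient 2"
    "- 3 * fermat_quotient p 3 - 4 * fermat_quotient p 2
         + of_nat p * (3 / 2 * (fermat_quotient p 3)\<^sup>2 + 2 * (fermat_quotient p 2)\<^sup>2)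
       = - 3 * log_quotient 3 - 4 * log_quotient 2"
    by (simp_all add: log_quotient_def algebra_simps)
  have lq: "log_quotient 2 \<in> Zp" "log_quotient 3 \<in> Zp"
    unfolding log_quotient_def using fermat_quotient_in_Zp
    by (auto intro!: p_integers_diff half_in_Zp p_integers_mult p_integers_power)
  have Zp: "- 4 * log_quotient 2 \<in> Zp" "- 3 * log_quotient 3 \<in> Zp" "- 6 * log_quotient 2 \<in> Zp"
    "- 3 * log_quotient 3 - 4 * log_quotient 2 \<in> Zp"
    using lq by (auto intro!: p_integers_diff p_integers_mult p_integers_minus)
  have mods: "p mod 2 = 1 \<or> p mod 2 = 2 - 1" "p mod 3 = 1 \<or> p mod 3 = 3 - 1"
    "p mod 4 = 1 \<or> p mod 4 = 4 - 1" "p mod 6 = 1 \<or> p mod 6 = 6 - 1"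
    using p_mod_6 by presburger+
  have L6: "Legendre (- 1) (int p) = (- 1) ^ (p div 6)"
    unfolding Legendre_minus_1 minus_one_power_iff by (simp add: even_div_2_iff_even_div_6)
  show ?thesis
    unfolding rhs
    by (intro conjI signed_sum_pcong[OF _ _ _ gbinomial_pair_minus_inverse_2[symmetric]]
          signed_sum_pcong[OF _ _ _ gbinomial_pair_minus_inverse_3[symmetric]]
          signed_sum_pcong[OF _ _ _ gbinomial_pair_minus_inverse_4[symmetric]]
          signed_sum_pcong[OF _ _ _ gbinomial_pair_minus_inverse_6[symmetric]]
          Zp class_sum_log_quotient mods coprime_6 Legendre_minus_1 Legendre_3 Legendre_minus_2 L6) simp_all
qed

end
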